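(* For every $d\in\mathbb{N}$, $d\ge 1$, let $\mathcal{B}_d$ be a bounded orthonormal system and let $F_d\subset\mathcal{A}_0(\mathcal{B}_d)$. Assume that there are positive constants $c_1,c_2,\alpha,\beta$ and $\gamma$ such that \[ C_{\mathcal{B}_d}\le c_1 d^{\alpha}\qquad\text{and}\qquad N^\infty_{\mathcal{B}_d}(\varepsilon,F_d)\le\exp(c_2 d^{\beta}\varepsilon^{-\gamma}) \] for all $\varepsilon>0$ and all $d$. Then, for every $1\le p<\infty$, the problem of sampling recovery on $F_d$ in $L_p$ is polynomially tractable.
   Context: Bounded orthonormal system: Let $\mu$ be a probability measure on a set $D$ and let $\mathcal{B}=\{b_k\mid k\in I\}$ be a countable orthonormal system in $L_2(D,\mu)$ with $C_{\mathcal{B}}:=\sup_{k\in I}\|b_k\|_\infty<\infty$ (sup norm). Then $\mathcal{B}$ is called a bounded orthonormal system. The set $D$ and the measure $\mu$ may depend on $d$ for $\mathcal{B}=\mathcal{B}_d$. $L_p$ means $L_p(D,\mu)$. For absolutely summable $(c_k)_{k\in I}$ the series $f=\sum_{k\in I} c_kb_k$ converges uniformly on $D$ and $\hat f(k):=\int_D f\,\overline{b_k}\,d\mu=c_k$. The Wiener algebra is \[ \mathcal{A}(\mathcal{B}):=\Big\{f=\sum_{k\in I}c_kb_k\ \Big|\ \|f\|_{\mathcal{A}}:=\sum_{k\in I}|c_k|<\infty\Big\}, \] and $\mathcal{A}_0(\mathcal{B})$ denotes its unit ball. Projection error: For a finite $\Lambda\subset I$ let $P_\Lambda f:=\sum_{k\in\Lambda}\hat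 f(k)b_k$. For $F\subset\mathcal{A}(\mathcal{B})$ put $E^\infty_\Lambda(F):=\sup_{f\in F}\|f-P_\Lambda f\|_\infty$ and \[ N^\infty_{\mathcal{B}}(\varepsilon,F):=\min\{\#\Lambda\mid \Lambda\subset I\text{ finite},\ E^\infty_\Lambda(F)\le\varepsilon\}. \] Complexity: $n(\varepsilon,F,L_p)$ is the minimal $n\in\mathbb{N}=\{0,1,2,\dots\}$ for which there are points $x_1,\dots,x_n\in D$ and a (possibly non-linear) map $\phi\colon\mathbb{C}^n\to L_p$ such that $A_n(f)=\phi(f(x_1),\dots,f(x_n))$ satisfies $\sup_{f\in F}\|f-A_n(f)\|_p\le\varepsilon$ (for $n=0$, $A_n$ is a constant map). Sampling recovery on $F_d$ in $L_p$ is polynomially tractable if there exist $C,q,r\ge 0$ such that $n(\varepsilon,F_d,L_p)\le C d^q\varepsilon^{-r}$ for all $d\ge 1$ and all $\varepsilon>0$. *)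

theory Defs
  imports "HOL-Probability.Probability_Measure" "HOL-Library.Extended_Nat"
begin

text \<open>
  The set \<open>D\<close> is \<open>space M\<close>. All functions are genuine functions, not equivalence classes, and
  their values outside \<open>space M\<close> are irrelevant. Suprema that may be infinite or range over the
  empty set live in \<^typ>\<open>ennreal\<close>.
\<close>

definition sup_norm :: "'a set \<Rightarrow> ('a \<Rightarrow> complex) \<Rightarrow> ennreal" where
  "sup_norm D f = (SUP x\<in>D. ennreal (cmod (f x)))"

definition Lp_space :: "'a measure \<Rightarrow> real \<Rightarrow> ('a \<Rightarrow> complex) set" where
  "Lp_space M p = {f \<in> borel_measurable M. integrable M (\<lambda>x. cmod (f x) powr p)}"

definition Lp_norm :: "'a measure \<Rightarrow> real \<Rightarrow> ('a \<Rightarrow> complex) \<Rightarrow> ennreal" where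
  "Lp_norm M p f =
     (if f \<in> Lp_space M p
      then ennreal ((\<integral>x. cmod (f x) powr p \<partial>M) powr (1 / p))
      else top)"

definition L2_inner :: "'a measure \<Rightarrow> ('a \<Rightarrow> complex) \<Rightarrow> ('a \<Rightarrow> complex) \<Rightarrow> complex" where
  "L2_inner M f g = (\<integral>x. f x * cnj (g x) \<partial>M)"

definition system_bound :: "'a measure \<Rightarrow> 'i set \<Rightarrow> ('i \<Rightarrow> 'a \<Rightarrow> complex) \<Rightarrow> ennreal" where
  "system_bound M I b = (SUP k\<in>I. sup_norm (space M) (b k))"

locale bounded_orthonormal_system = prob_space M
  for M :: "'a measure" and I :: "'i set" and b :: "'i \<Rightarrow> 'a \<Rightarrow> complex" +
  assumes countable_index: "countable I"
    and in_L2: "k \<in> I \<Longrightarrow> b k \<in> Lp_space M 2"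
    and orthonormal: "k \<in> I \<Longrightarrow> l \<in> I \<Longrightarrow> L2_inner M (b k) (b l) = (if k = l then 1 else 0)"
    and bounded: "system_bound M I b < top"

definition wiener_expansion ::
    "'a measure \<Rightarrow> 'i set \<Rightarrow> ('i \<Rightarrow> 'a \<Rightarrow> complex) \<Rightarrow> ('i \<Rightarrow> complex) \<Rightarrow> ('a \<Rightarrow> complex) \<Rightarrow> bool" where
  "wiener_expansion M I b c f \<longleftrightarrow>
     (\<lambda>k. cmod (c k)) summable_on I \<and>
     (\<forall>x\<in>space M. ((\<lambda>k. c k * b k x) has_sum f x) I)"

definition wiener_algebra ::
    "'a measure \<Rightarrow> 'i set \<Rightarrow> ('i \<Rightarrow> 'a \<Rightarrow> complex) \<Rightarrow> ('a \<Rightarrow> complex) set" where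
  "wiener_algebra M I b = {f. \<exists>c. wiener_expansion M I b c f}"

text \<open>
  The description below is unique because the coefficients on \<open>I\<close> are determined by \<open>f\<close>; see
  \<open>wiener_expansion_unique\<close> and \<open>wiener_norm_eq\<close>.
\<close>

definition wiener_norm ::
    "'a measure \<Rightarrow> 'i set \<Rightarrow> ('i \<Rightarrow> 'a \<Rightarrow> complex) \<Rightarrow> ('a \<Rightarrow> complex) \<Rightarrow> real" where
  "wiener_norm M I b f =
     (THE s. \<exists>c. wiener_expansion M I b c f \<and> s = (\<Sum>\<^sub>\<infinity>k\<in>I. cmod (c k)))"

definition wiener_unit_ball ::
    "'a measure \<Rightarrow> 'i set \<Rightarrow> ('i \<Rightarrow> 'a \<Rightarrow> complex) \<Rightarrow> ('a \<Rightarrow> complex) set" where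
  "wiener_unit_ball M I b = {f \<in> wiener_algebra M I b. wiener_norm M I b f \<le> 1}"

definition projection ::
    "'a measure \<Rightarrow> ('i \<Rightarrow> 'a \<Rightarrow> complex) \<Rightarrow> 'i set \<Rightarrow> ('a \<Rightarrow> complex) \<Rightarrow> 'a \<Rightarrow> complex" where
  "projection M b \<Lambda> f = (\<lambda>x. \<Sum>k\<in>\<Lambda>. L2_inner M f (b k) * b k x)"

definition projection_error ::
    "'a measure \<Rightarrow> ('i \<Rightarrow> 'a \<Rightarrow> complex) \<Rightarrow> 'i set \<Rightarrow> ('a \<Rightarrow> complex) set \<Rightarrow> ennreal" where
  "projection_error M b \<Lambda> F =
     (SUP f\<in>F. sup_norm (space M) (\<lambda>x. f x - projection M b \<Lambda> f x))"

text \<open>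
  On \<^typ>\<open>enat\<close> the infimum of a nonempty set is its minimum, and the infimum of the empty set
  is \<open>\<infinity>\<close>.
\<close>

definition projection_number ::
    "'a measure \<Rightarrow> 'i set \<Rightarrow> ('i \<Rightarrow> 'a \<Rightarrow> complex) \<Rightarrow> real \<Rightarrow> ('a \<Rightarrow> complex) set \<Rightarrow> enat" where
  "projection_number M I b \<epsilon> F =
     Inf {enat (card \<Lambda>) | \<Lambda>. finite \<Lambda> \<and> \<Lambda> \<subseteq> I \<and> projection_error M b \<Lambda> F \<le> ennreal \<epsilon>}"

text \<open>
  Vectors in \<open>\<complex>\<^sup>n\<close> and \<open>n\<close>-tuples of points are lists of length \<open>n\<close>.
\<close>

definition sampling_complexity ::
    "'a measure \<Rightarrow> real \<Rightarrow> ('a \<Rightarrow> complex) set \<Rightarrow> real \<Rightarrow> enat" where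
  "sampling_complexity M \<epsilon> F p =
     Inf {enat n | n. \<exists>xs \<phi>.
       length xs = n \<and> set xs \<subseteq> space M \<and>
       (\<forall>ys. length ys = n \<longrightarrow> \<phi> ys \<in> Lp_space M p) \<and>
       (SUP f\<in>F. Lp_norm M p (\<lambda>x. f x - \<phi> (map f xs) x)) \<le> ennreal \<epsilon>}"

definition polynomially_tractable ::
    "(nat \<Rightarrow> 'a measure) \<Rightarrow> (nat \<Rightarrow> ('a \<Rightarrow> complex) set) \<Rightarrow> real \<Rightarrow> bool" where
  "polynomially_tractable M F p \<longleftrightarrow>
     (\<exists>C q r. 0 \<le> C \<and> 0 \<le> q \<and> 0 \<le> r \<and>
       (\<forall>d\<ge>1. \<forall>\<epsilon>>0.
          ennreal_of_enat (sampling_complexity (M d) \<epsilon> (F d) p)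
            \<le> ennreal (C * real d powr q * \<epsilon> powr (- r))))"

context bounded_orthonormal_system
begin

lemma wiener_expansion_zero:
  assumes e: "wiener_expansion M I b e (\<lambda>_. 0)" and k: "k \<in> I"
  shows "e k = 0"
proof (rule ccontr)
  assume nz: "e k \<noteq> 0"
  define B where "B = enn2real (system_bound M I b)"
  have B: "cmod (b j x) \<le> B" if "j \<in> I" "x \<in> space M" for j x
  proof -
    have "ennreal (cmod (b j x)) \<le> sup_norm (space M) (b j)"
      unfolding sup_norm_def using that by (intro SUP_upper)
    also have "\<dots> \<le> system_bound M I b"
      unfolding system_bound_def using that by (intro SUP_upper)
    also have "\<dots> = ennreal B" using bounded by (simp add: B_def)
    finally show ?thesis by (simp add: B_def)
  qed
  have B0: "B \<ge> 0" by (simp add: B_def)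
  have meas: "b j \<in> borel_measurable M" if "j \<in> I" for j
    using in_L2[OF that] by (simp add: Lp_space_def)
  have summ: "(\<lambda>j. cmod (e j)) summable_on I"
    and sum0: "\<And>x. x \<in> space M \<Longrightarrow> ((\<lambda>j. e j * b j x) has_sum 0) I"
    using e by (auto simp: wiener_expansion_def)
  define \<delta> where "\<delta> = cmod (e k) / (2 * (B * B + 1))"
  have \<delta>: "\<delta> > 0" using nz by (simp add: \<delta>_def add_nonneg_pos)
  obtain S0 where S0: "finite S0" "S0 \<subseteq> I"
      "dist (\<Sum>j\<in>S0. cmod (e j)) (\<Sum>\<^sub>\<infinity>j\<in>I. cmod (e j)) \<le> \<delta>"
    using infsum_finite_approximation[OF summ \<delta>] by blast
  define S where "S = insert k S0"
  have S: "finite S" "S \<subseteq> I" "k \<in> S" using S0 k by (auto simp: S_def)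
  have split: "(\<Sum>\<^sub>\<infinity>j\<in>I. cmod (e j)) = (\<Sum>j\<in>S. cmod (e j)) + (\<Sum>\<^sub>\<infinity>j\<in>I - S. cmod (e j))"
    using infsum_Diff[OF summ _ S(2)] S by (simp add: summable_on_finite)
  have "(\<Sum>j\<in>S0. cmod (e j)) \<le> (\<Sum>j\<in>S. cmod (e j))"
    using S by (intro sum_mono2) (auto simp: S_def)
  then have tail: "(\<Sum>\<^sub>\<infinity>j\<in>I - S. cmod (e j)) \<le> \<delta>"
    using S0(3) split by (simp add: dist_real_def)
  define g where "g x = (\<Sum>j\<in>S. e j * b j x)" for x
  have g: "cmod (g x) \<le> B * \<delta>" if x: "x \<in> space M" for x
  proof -
    have "((\<lambda>j. e j * b j x) has_sum (0 - g x)) (I - S)"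
      unfolding g_def using sum0[OF x] S
      by (intro has_sum_Diff has_sum_finite) auto
    moreover have "((\<lambda>j. cmod (e j) * B) has_sum ((\<Sum>\<^sub>\<infinity>j\<in>I - S. cmod (e j)) * B)) (I - S)"
      using summable_on_subset_banach[OF summ, of "I - S"]
      by (intro has_sum_cmult_left has_sum_infsum) auto
    ultimately have "cmod (0 - g x) \<le> (\<Sum>\<^sub>\<infinity>j\<in>I - S. cmod (e j)) * B"
      by (rule norm_infsum_le) (use B x in \<open>auto simp: norm_mult intro!: mult_left_mono\<close>)
    also have "\<dots> \<le> \<delta> * B" using tail B0 by (rule mult_right_mono)
    finally show ?thesis by (simp add: mult.commute)
  qed
  have int: "integrable M (\<lambda>x. e j * (b j x * cnj (b k x)))" if "j \<in> S" for j
  proof (rule integrable_mult_right, rule integrable_const_bound[where B = "B * B"])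
    show "AE x in M. cmod (b j x * cnj (b k x)) \<le> B * B"
      using that S k B B0 by (intro AE_I2) (auto simp: norm_mult intro!: mult_mono)
    have "b j \<in> borel_measurable M" "b k \<in> borel_measurable M"
      using that S k meas by auto
    moreover have "cnj \<in> borel_measurable borel"
      by (intro borel_measurable_continuous_onI continuous_intros)
    ultimately show "(\<lambda>x. b j x * cnj (b k x)) \<in> borel_measurable M"
      by measurable
  qed
  have gk: "(\<lambda>x. g x * cnj (b k x)) = (\<lambda>x. \<Sum>j\<in>S. e j * (b j x * cnj (b k x)))"
    by (simp add: g_def sum_distrib_right mult.assoc)
  have gint: "integrable M (\<lambda>x. g x * cnj (b k x))"
    unfolding gk using int by (rule Bochner_Integration.integrable_sum)
  have "(\<integral>x. g x * cnj (b k x) \<partial>M) = (\<Sum>j\<in>S. e j * L2_inner M (b j) (b k))"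
    unfolding gk L2_inner_def using int by (subst Bochner_Integration.integral_sum) auto
  also have "\<dots> = (\<Sum>j\<in>S. if j = k then e j else 0)"
    using S k orthonormal by (intro sum.cong) auto
  also have "\<dots> = e k" using S by simp
  finally have "cmod (e k) = cmod (\<integral>x. g x * cnj (b k x) \<partial>M)" by simp
  also have "\<dots> \<le> (\<integral>x. cmod (g x * cnj (b k x)) \<partial>M)" by (rule integral_norm_bound)
  also have "\<dots> \<le> (\<integral>x. B * \<delta> * B \<partial>M)"
  proof (rule integral_mono)
    show "integrable M (\<lambda>x. cmod (g x * cnj (b k x)))" using gint by (rule integrable_norm)
    show "cmod (g x * cnj (b k x)) \<le> B * \<delta> * B" if "x \<in> space M" for x
      using g[OF that] B[OF k that] B0 \<delta> by (auto simp: norm_mult intro!: mult_mono)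
  qed simp
  also have "\<dots> = B * B * \<delta>" by (simp add: prob_space)
  also have "\<dots> \<le> (B * B + 1) * \<delta>" using \<delta> by (intro mult_right_mono) auto
  also have "\<dots> = cmod (e k) / 2"
    using add_nonneg_pos[of "B * B" 1] by (simp add: \<delta>_def divide_simps)
  finally show False using nz by simp
qed

lemma wiener_expansion_unique:
  assumes "wiener_expansion M I b c f" "wiener_expansion M I b c' f" "k \<in> I"
  shows "c k = c' k"
proof -
  have "(\<lambda>j. cmod (c j - c' j)) summable_on I"
    by (rule summable_on_comparison_test[OF summable_on_add[of "\<lambda>j. cmod (c j)" I "\<lambda>j. cmod (c' j)"]])
       (use assms in \<open>auto simp: wiener_expansion_def norm_triangle_ineq4\<close>)
  moreover have "((\<lambda>j. (c j - c' j) * b j x) has_sum 0) I" if "x \<in> space M" for x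
  proof -
    have "((\<lambda>j. c j * b j x) has_sum f x) I" "((\<lambda>j. - (c' j * b j x)) has_sum - f x) I"
      using assms that by (auto simp: wiener_expansion_def has_sum_uminus)
    from has_sum_add[OF this] show ?thesis by (simp add: left_diff_distrib)
  qed
  ultimately have "wiener_expansion M I b (\<lambda>j. c j - c' j) (\<lambda>_. 0)"
    by (simp add: wiener_expansion_def)
  from wiener_expansion_zero[OF this assms(3)] show ?thesis by simp
qed

lemma wiener_norm_eq:
  assumes "wiener_expansion M I b c f"
  shows "wiener_norm M I b f = (\<Sum>\<^sub>\<infinity>k\<in>I. cmod (c k))"
  unfolding wiener_norm_def
proof (rule the_equality)
  fix s assume "\<exists>c. wiener_expansion M I b c f \<and> s = (\<Sum>\<^sub>\<infinity>k\<in>I. cmod (c k))"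
  then obtain c' where "wiener_expansion M I b c' f" "s = (\<Sum>\<^sub>\<infinity>k\<in>I. cmod (c' k))" by blast
  then show "s = (\<Sum>\<^sub>\<infinity>k\<in>I. cmod (c k))"
    using wiener_expansion_unique[OF _ assms] by (auto intro!: infsum_cong)
qed (use assms in auto)

end

end

theory Submission
  imports Defs "HOL-Probability.Hoeffding"
begin

text \<open>
  Membership of \<open>f\<close> in the Wiener unit ball makes \<open>P f\<close>, the projection of \<open>f\<close> to the span of a
  finite set \<open>\<Lambda>\<close>, a combination \<open>\<Sum>k\<in>\<Lambda>. a k * b k\<close> with \<open>\<Sum>k\<in>\<Lambda>. cmod (a k) \<le> 1\<close>. For such
  combinations a sample of size logarithmic in \<open>card \<Lambda>\<close> determines the \<open>L\<^sub>2\<close> norm: the square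
  \<open>(cmod h)\<^sup>2\<close> of \<open>h = (\<Sum>k\<in>\<Lambda>. e k * b k)\<close> is a combination of the products \<open>b k * cnj (b l)\<close>
  whose coefficients have absolute values with sum \<open>(\<Sum>k\<in>\<Lambda>. cmod (e k))\<^sup>2\<close>. If the sample means of
  all these products are within \<open>t\<close> of their integrals, then the sample mean of \<open>(cmod h)\<^sup>2\<close> is
  within \<open>(\<Sum>k\<in>\<Lambda>. cmod (e k))\<^sup>2 * t\<close> of its integral (\<open>combination_L2_le_sample_sum\<close>). There are
  \<open>(card \<Lambda>)\<^sup>2\<close> products, all bounded by \<open>K\<^sup>2\<close> where \<open>K\<close> bounds the system, so by exponential
  concentration about \<open>K ^ 4 / t\<^sup>2 * ln (card \<Lambda>)\<close> points suffice (\<open>exists_good_sampling_points\<close>).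

  The recovery map returns any combination \<open>g = (\<Sum>k\<in>\<Lambda>. e k * b k)\<close> with
  \<open>\<Sum>k\<in>\<Lambda>. cmod (e k) \<le> 1\<close> that fits the data up to \<open>\<delta>\<close>, where \<open>\<delta>\<close> is the uniform projection
  error; the coefficients of \<open>P f\<close> show that there is one. The difference \<open>h = P f - g\<close> has
  coefficient sum at most 2 and is at most \<open>2 * \<delta>\<close> at the sample points. Hence its \<open>L\<^sub>2\<close> norm is
  small, and so is that of \<open>f - g\<close> (\<open>exists_recovery_map\<close>). Since \<open>f - g\<close> is bounded by \<open>2 * K\<close>, a
  Chebyshev estimate turns this into an \<open>L\<^sub>p\<close> bound (\<open>Lp_norm_le_of_second_moment\<close>).

  For accuracy \<open>\<epsilon>\<close> in \<open>L\<^sub>p\<close> it is enough that \<open>\<delta>\<^sup>2\<close> is a constant times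
  \<open>\<epsilon> powr (p + 2) / K powr p\<close>. By assumption \<open>K\<close> and the logarithm of the projection number are
  polynomial in \<open>d\<close> and \<open>1 / \<epsilon>\<close>, and therefore so is the number of points. For \<open>\<epsilon> \<ge> K\<close> the zero
  function is a good enough approximation, and no points are needed.
\<close>

section \<open>Points whose sample means are close to the integrals\<close>

lemma (in prob_space) expectation_exp_deviation_le:
  fixes g :: "'a \<Rightarrow> real"
  assumes meas [measurable]: "g \<in> borel_measurable M"
    and bound: "\<And>x. x \<in> space M \<Longrightarrow> \<bar>g x\<bar> \<le> K"
    and "l > 0"
  shows "integrable M (\<lambda>x. exp (l * (g x - expectation g)))"
    and "expectation (\<lambda>x. exp (l * (g x - expectation g))) \<le> exp (l\<^sup>2 * K\<^sup>2 / 2)"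
proof -
  interpret interval_bounded_random_variable M g "- K" K
    using bound by unfold_locales (auto intro!: AE_I2 simp: abs_le_iff minus_le_iff)
  show int: "integrable M (\<lambda>x. exp (l * (g x - expectation g)))"
  proof (rule integrable_const_bound[where B = "exp (l * (K - expectation g))"])
    have "g x \<le> K" if "x \<in> space M" for x
      using bound[OF that] by simp
    then show "AE x in M. norm (exp (l * (g x - expectation g))) \<le> exp (l * (K - expectation g))"
      using \<open>l > 0\<close> by (intro AE_I2) (simp add: mult_left_mono)
  qed simp
  have "ennreal (expectation (\<lambda>x. exp (l * (g x - expectation g))))
          = (\<integral>\<^sup>+x. exp (l * (g x - expectation g)) \<partial>M)"
    by (intro nn_integral_eq_integral[symmetric] int AE_I2) simp
  also have "\<dots> \<le> ennreal (exp (l\<^sup>2 * (K - - K)\<^sup>2 / 8))"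
    using \<open>l > 0\<close> by (rule Hoeffdings_lemma_nn_integral)
  finally show "expectation (\<lambda>x. exp (l * (g x - expectation g))) \<le> exp (l\<^sup>2 * K\<^sup>2 / 2)"
    by (simp add: power2_eq_square mult_ac)
qed

lemma (in prob_space) exists_le_expectation:
  fixes X :: "'a \<Rightarrow> real"
  assumes "integrable M X"
  obtains x where "x \<in> space M" "X x \<le> expectation X"
proof (rule ccontr)
  assume "\<not> thesis"
  then have "AE x in M. expectation X < X x"
    using that by (intro AE_I2) (meson not_le_imp_less)
  from expectation_greater[OF assms this] show False by simp
qed

text \<open>
  The points are found one at a time. Averaged over the next point, the exponential potential
  grows at most by the factor from Hoeffding's lemma, so some point does no worse than the average.
  This replaces the usual argument with independent random points and a union bound, and it needs
  no product measure.
\<close>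

lemma (in prob_space) exists_points_exp_sum_le:
  fixes g :: "'j \<Rightarrow> 'a \<Rightarrow> real"
  assumes meas: "\<And>j. j \<in> J \<Longrightarrow> g j \<in> borel_measurable M"
    and bound: "\<And>j x. j \<in> J \<Longrightarrow> x \<in> space M \<Longrightarrow> \<bar>g j x\<bar> \<le> K"
    and "l > 0"
  shows "\<exists>xs. length xs = n \<and> set xs \<subseteq> space M \<and>
           (\<Sum>j\<in>J. exp (l * (\<Sum>x\<leftarrow>xs. g j x - expectation (g j))))
             \<le> card J * exp (l\<^sup>2 * K\<^sup>2 / 2) ^ n"
proof (induction n)
  case 0
  show ?case by simp
next
  case (Suc n)
  then obtain xs where xs: "length xs = n" "set xs \<subseteq> space M"
    and pot: "(\<Sum>j\<in>J. exp (l * (\<Sum>x\<leftarrow>xs. g j x - expectation (g j))))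
               \<le> card J * exp (l\<^sup>2 * K\<^sup>2 / 2) ^ n"
    by blast
  define w where "w j = exp (l * (\<Sum>x\<leftarrow>xs. g j x - expectation (g j)))" for j
  define X where "X x = (\<Sum>j\<in>J. w j * exp (l * (g j x - expectation (g j))))" for x
  have int: "integrable M (\<lambda>x. w j * exp (l * (g j x - expectation (g j))))" if "j \<in> J" for j
    using expectation_exp_deviation_le(1)[OF meas bound \<open>l > 0\<close>] that by simp
  then have intX: "integrable M X"
    unfolding X_def by (rule Bochner_Integration.integrable_sum)
  obtain z where z: "z \<in> space M" "X z \<le> expectation X"
    using exists_le_expectation[OF intX] .
  have "X z \<le> expectation X" by (rule z)
  also have "expectation X
      = (\<Sum>j\<in>J. w j * expectation (\<lambda>x. exp (l * (g j x - expectation (g j)))))"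
    unfolding X_def using int by (subst Bochner_Integration.integral_sum) auto
  also have "\<dots> \<le> (\<Sum>j\<in>J. w j * exp (l\<^sup>2 * K\<^sup>2 / 2))"
    using expectation_exp_deviation_le(2)[OF meas bound \<open>l > 0\<close>]
    by (intro sum_mono mult_left_mono) (auto simp: w_def)
  also have "\<dots> = (\<Sum>j\<in>J. w j) * exp (l\<^sup>2 * K\<^sup>2 / 2)"
    by (simp add: sum_distrib_right)
  also have "\<dots> \<le> card J * exp (l\<^sup>2 * K\<^sup>2 / 2) ^ n * exp (l\<^sup>2 * K\<^sup>2 / 2)"
    using pot by (intro mult_right_mono) (auto simp: w_def)
  finally have "X z \<le> card J * exp (l\<^sup>2 * K\<^sup>2 / 2) ^ Suc n"
    by (simp add: mult_ac)
  moreover have "X z = (\<Sum>j\<in>J. exp (l * (\<Sum>x\<leftarrow>z # xs. g j x - expectation (g j))))"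
    by (simp add: X_def w_def distrib_left exp_add mult.commute)
  ultimately show ?case
    using xs z(1) by (intro exI[of _ "z # xs"]) simp
qed

text \<open>
  The potential is a sum of positive terms, so each single term, the exponential of one deviation,
  is bounded by the whole sum.
\<close>

lemma (in prob_space) exists_points_sum_le:
  fixes g :: "'j \<Rightarrow> 'a \<Rightarrow> real" and t :: real
  assumes fin: "finite J"
    and meas: "\<And>j. j \<in> J \<Longrightarrow> g j \<in> borel_measurable M"
    and bound: "\<And>j x. j \<in> J \<Longrightarrow> x \<in> space M \<Longrightarrow> \<bar>g j x\<bar> \<le> K"
    and "K > 0" "t > 0"
    and card: "card J \<le> exp (n * t\<^sup>2 / (2 * K\<^sup>2))"
  shows "\<exists>xs. length xs = n \<and> set xs \<subseteq> space M \<and>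
           (\<forall>j\<in>J. (\<Sum>x\<leftarrow>xs. g j x - expectation (g j)) \<le> n * t)"
proof -
  \<comment> \<open>this choice minimises \<open>l\<^sup>2 * K\<^sup>2 / 2 - l * t\<close>\<close>
  define l where "l = t / K\<^sup>2"
  have "l > 0" using \<open>K > 0\<close> \<open>t > 0\<close> by (simp add: l_def)
  have "\<exists>xs. length xs = n \<and> set xs \<subseteq> space M \<and>
          (\<Sum>j\<in>J. exp (l * (\<Sum>x\<leftarrow>xs. g j x - expectation (g j))))
            \<le> card J * exp (l\<^sup>2 * K\<^sup>2 / 2) ^ n"
    by (rule exists_points_exp_sum_le) (use meas bound \<open>l > 0\<close> in auto)
  then obtain xs where xs: "length xs = n" "set xs \<subseteq> space M"
    and pot: "(\<Sum>j\<in>J. exp (l * (\<Sum>x\<leftarrow>xs. g j x - expectation (g j))))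
               \<le> card J * exp (l\<^sup>2 * K\<^sup>2 / 2) ^ n"
    by (elim exE conjE)
  have "(\<Sum>x\<leftarrow>xs. g j x - expectation (g j)) \<le> n * t" if "j \<in> J" for j
  proof -
    have "exp (l * (\<Sum>x\<leftarrow>xs. g j x - expectation (g j)))
            \<le> (\<Sum>j\<in>J. exp (l * (\<Sum>x\<leftarrow>xs. g j x - expectation (g j))))"
      using that fin by (intro member_le_sum) auto
    also have "\<dots> \<le> card J * exp (l\<^sup>2 * K\<^sup>2 / 2) ^ n" by (rule pot)
    also have "\<dots> \<le> exp (n * t\<^sup>2 / (2 * K\<^sup>2)) * exp (l\<^sup>2 * K\<^sup>2 / 2) ^ n"
      using card by (intro mult_right_mono) auto
    also have "\<dots> = exp (n * t\<^sup>2 / (2 * K\<^sup>2) + n * (l\<^sup>2 * K\<^sup>2 / 2))"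
      by (simp only: exp_add exp_of_nat_mult)
    also have "n * t\<^sup>2 / (2 * K\<^sup>2) + n * (l\<^sup>2 * K\<^sup>2 / 2) = l * (n * t)"
      using \<open>K > 0\<close> by (simp add: l_def power2_eq_square field_simps)
    finally show ?thesis using \<open>l > 0\<close> by simp
  qed
  with xs show ?thesis by blast
qed

text \<open>
  The four one-sided bounds for real parts after multiplication by 1, -1, \<open>\<i>\<close> and \<open>-\<i>\<close> control
  the real and imaginary parts of a complex deviation; this is where the factor 4 comes from, and
  the accuracy \<open>t / 2\<close> for each part turns the constant 2 in the exponent into 8.
\<close>

lemma (in prob_space) exists_points_mean_approx:
  fixes u :: "'j \<Rightarrow> 'a \<Rightarrow> complex" and t :: real
  assumes fin: "finite J"
    and meas: "\<And>j. j \<in> J \<Longrightarrow> u j \<in> borel_measurable M"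
    and bound: "\<And>j x. j \<in> J \<Longrightarrow> x \<in> space M \<Longrightarrow> cmod (u j x) \<le> K"
    and "K > 0" "t > 0"
    and card: "4 * card J \<le> exp (n * t\<^sup>2 / (8 * K\<^sup>2))"
  shows "\<exists>xs. length xs = n \<and> set xs \<subseteq> space M \<and>
           (\<forall>j\<in>J. cmod (\<Sum>x\<leftarrow>xs. u j x - expectation (u j)) \<le> n * t)"
proof -
  define W where "W = {1, -1, \<i>, -\<i>}"
  define g where "g = (\<lambda>(j, w) x. Re (w * u j x))"
  have W: "finite W" "card W \<le> 4" "\<And>w. w \<in> W \<Longrightarrow> cmod w = 1"
    unfolding W_def using card_length[of "[1, -1, \<i>, -\<i>]"] by auto
  have int: "integrable M (u j)" if "j \<in> J" for j
    using meas[OF that] bound[OF that] by (intro integrable_const_bound[where B = K] AE_I2)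
  have Eg: "expectation (g (j, w)) = Re (w * expectation (u j))" if "j \<in> J" for j w
    using int[OF that] by (simp add: g_def)
  have "\<exists>xs. length xs = n \<and> set xs \<subseteq> space M \<and>
          (\<forall>p\<in>J \<times> W. (\<Sum>x\<leftarrow>xs. g p x - expectation (g p)) \<le> n * (t / 2))"
  proof (rule exists_points_sum_le[where K = K])
    show "g p \<in> borel_measurable M" if "p \<in> J \<times> W" for p
      using that meas by (auto simp: g_def)
    show "\<bar>g p x\<bar> \<le> K" if "p \<in> J \<times> W" "x \<in> space M" for p x
    proof -
      obtain j w where p: "p = (j, w)" "j \<in> J" "w \<in> W" using \<open>p \<in> J \<times> W\<close> by blast
      have "\<bar>g p x\<bar> \<le> cmod (w * u j x)" by (simp only: p g_def prod.case abs_Re_le_cmod)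
      also have "\<dots> \<le> K" using bound W(3) p that by (simp add: norm_mult)
      finally show ?thesis .
    qed
    have "real (card (J \<times> W)) \<le> real (4 * card J)"
      using W(2) mult_le_mono2[of "card W" 4 "card J"] by (simp only: card_cartesian_product of_nat_le_iff)
        (simp add: mult.commute)
    also have "\<dots> \<le> exp (n * (t / 2)\<^sup>2 / (2 * K\<^sup>2))"
      using card by (simp add: power_divide)
    finally show "real (card (J \<times> W)) \<le> exp (n * (t / 2)\<^sup>2 / (2 * K\<^sup>2))" .
  qed (use fin W \<open>K > 0\<close> \<open>t > 0\<close> in auto)
  then obtain xs where xs: "length xs = n" "set xs \<subseteq> space M"
    and le: "\<And>j w. j \<in> J \<Longrightarrow> w \<in> W \<Longrightarrow>
               (\<Sum>x\<leftarrow>xs. g (j, w) x - expectation (g (j, w))) \<le> n * (t / 2)"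
    by blast
  have "cmod (\<Sum>x\<leftarrow>xs. u j x - expectation (u j)) \<le> n * t" if "j \<in> J" for j
  proof -
    define S where "S = (\<Sum>x\<leftarrow>xs. u j x - expectation (u j))"
    have "(\<Sum>x\<leftarrow>xs. g (j, w) x - expectation (g (j, w))) = Re (w * S)" for w
      unfolding S_def Eg[OF that] by (induction xs) (simp_all add: g_def algebra_simps)
    then have *: "Re (w * S) \<le> n * (t / 2)" if "w \<in> W" for w
      using le[OF \<open>j \<in> J\<close> that] by simp
    have "\<bar>Re S\<bar> \<le> n * (t / 2)" "\<bar>Im S\<bar> \<le> n * (t / 2)"
      using *[of 1] *[of "-1"] *[of \<i>] *[of "-\<i>"] by (auto simp: W_def abs_le_iff)
    with cmod_le[of S] show ?thesis unfolding S_def by simp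
  qed
  with xs show ?thesis by blast
qed

section \<open>Expansions in the Wiener algebra\<close>

context bounded_orthonormal_system
begin

lemma basis_measurable [measurable]: "k \<in> I \<Longrightarrow> b k \<in> borel_measurable M"
  using in_L2 by (simp add: Lp_space_def)

lemma cmod_basis_le:
  assumes "system_bound M I b \<le> ennreal K" "0 \<le> K" "k \<in> I" "x \<in> space M"
  shows "cmod (b k x) \<le> K"
proof -
  have "ennreal (cmod (b k x)) \<le> sup_norm (space M) (b k)"
    unfolding sup_norm_def using assms by (intro SUP_upper)
  also have "\<dots> \<le> system_bound M I b"
    unfolding system_bound_def using assms by (intro SUP_upper)
  also have "\<dots> \<le> ennreal K" by (rule assms)
  finally show ?thesis using \<open>0 \<le> K\<close> by simp
qed

lemma cmod_combination_le:
  assumes bound: "\<And>k. k \<in> \<Lambda> \<Longrightarrow> cmod (b k x) \<le> K"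
    and e: "(\<Sum>k\<in>\<Lambda>. cmod (e k)) \<le> s" and "0 \<le> K"
  shows "cmod (\<Sum>k\<in>\<Lambda>. e k * b k x) \<le> s * K"
proof -
  have "cmod (\<Sum>k\<in>\<Lambda>. e k * b k x) \<le> (\<Sum>k\<in>\<Lambda>. cmod (e k) * K)"
    using bound by (intro sum_norm_le) (auto simp: norm_mult intro!: mult_left_mono)
  also have "\<dots> \<le> s * K"
    using e \<open>0 \<le> K\<close> by (simp add: mult_right_mono flip: sum_distrib_right)
  finally show ?thesis .
qed

lemma wiener_remainder_le:
  assumes f: "wiener_expansion M I b c f"
    and bound: "\<And>k. k \<in> I \<Longrightarrow> cmod (b k x) \<le> K"
    and S: "finite S" "S \<subseteq> I" and x: "x \<in> space M"
  shows "cmod (f x - (\<Sum>k\<in>S. c k * b k x)) \<le> ((\<Sum>\<^sub>\<infinity>k\<in>I. cmod (c k)) - (\<Sum>k\<in>S. cmod (c k))) * K"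
proof -
  have summ: "(\<lambda>k. cmod (c k)) summable_on I"
    and lim: "((\<lambda>k. c k * b k x) has_sum f x) I"
    using f x by (auto simp: wiener_expansion_def)
  have "((\<lambda>k. c k * b k x) has_sum (f x - (\<Sum>k\<in>S. c k * b k x))) (I - S)"
    using lim S by (intro has_sum_Diff has_sum_finite) auto
  moreover have "((\<lambda>k. cmod (c k) * K) has_sum
        (((\<Sum>\<^sub>\<infinity>k\<in>I. cmod (c k)) - (\<Sum>k\<in>S. cmod (c k))) * K)) (I - S)"
    using summ S by (intro has_sum_cmult_left has_sum_Diff has_sum_infsum has_sum_finite) auto
  ultimately show ?thesis
    by (rule norm_infsum_le) (use bound in \<open>auto simp: norm_mult intro!: mult_left_mono\<close>)
qed

text \<open>
  The supremum norm of a remainder is at most \<open>K\<close> times the corresponding tail of the absolutely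
  convergent coefficient series. The set \<open>S0\<close> allows a caller to force an index of interest
  into the partial sum.
\<close>

lemma wiener_uniform_approx:
  assumes f: "wiener_expansion M I b c f"
    and bound: "\<And>k x. k \<in> I \<Longrightarrow> x \<in> space M \<Longrightarrow> cmod (b k x) \<le> K"
    and "0 < K" "0 < \<delta>" and S0: "finite S0" "S0 \<subseteq> I"
  obtains S where "finite S" "S0 \<subseteq> S" "S \<subseteq> I"
    and "\<And>x. x \<in> space M \<Longrightarrow> cmod (f x - (\<Sum>k\<in>S. c k * b k x)) \<le> \<delta>"
proof -
  have summ: "(\<lambda>k. cmod (c k)) summable_on I"
    using f by (simp add: wiener_expansion_def)
  have "\<delta> / K > 0" using \<open>0 < K\<close> \<open>0 < \<delta>\<close> by simp
  from infsum_finite_approximation[OF summ this]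
  obtain T where T: "finite T" "T \<subseteq> I" "dist (\<Sum>k\<in>T. cmod (c k)) (\<Sum>\<^sub>\<infinity>k\<in>I. cmod (c k)) \<le> \<delta> / K"
    by blast
  have "(\<Sum>k\<in>T. cmod (c k)) \<le> (\<Sum>k\<in>S0 \<union> T. cmod (c k))"
    using S0 T by (intro sum_mono2) auto
  then have tail: "(\<Sum>\<^sub>\<infinity>k\<in>I. cmod (c k)) - (\<Sum>k\<in>S0 \<union> T. cmod (c k)) \<le> \<delta> / K"
    using T(3) by (simp add: dist_real_def)
  show thesis
  proof (rule that[of "S0 \<union> T"])
    fix x assume x: "x \<in> space M"
    have "cmod (f x - (\<Sum>k\<in>S0 \<union> T. c k * b k x))
        \<le> ((\<Sum>\<^sub>\<infinity>k\<in>I. cmod (c k)) - (\<Sum>k\<in>S0 \<union> T. cmod (c k))) * K"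
      using S0 T x by (intro wiener_remainder_le[OF f]) (auto intro!: bound)
    also have "\<dots> \<le> \<delta> / K * K" using tail \<open>0 < K\<close> by (intro mult_right_mono) auto
    finally show "cmod (f x - (\<Sum>k\<in>S0 \<union> T. c k * b k x)) \<le> \<delta>" using \<open>0 < K\<close> by simp
  qed (use S0 T in auto)
qed

text \<open>
  A uniform limit of finite combinations of measurable functions is measurable.
\<close>

lemma wiener_measurable:
  assumes f: "wiener_expansion M I b c f"
    and bound: "\<And>k x. k \<in> I \<Longrightarrow> x \<in> space M \<Longrightarrow> cmod (b k x) \<le> K"
    and "0 < K"
  shows "f \<in> borel_measurable M"
proof -
  have "\<exists>S. finite S \<and> S \<subseteq> I \<and>
          (\<forall>x\<in>space M. cmod (f x - (\<Sum>k\<in>S. c k * b k x)) \<le> inverse (real (Suc n)))" for n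
    by (rule wiener_uniform_approx[OF f bound \<open>0 < K\<close>, of "inverse (real (Suc n))" "{}"]) auto
  then obtain S where S: "\<And>n. finite (S n)" "\<And>n. S n \<subseteq> I"
    and approx: "\<And>n x. x \<in> space M \<Longrightarrow>
       cmod (f x - (\<Sum>k\<in>S n. c k * b k x)) \<le> inverse (real (Suc n))"
    by metis
  show ?thesis
  proof (rule borel_measurable_LIMSEQ_metric)
    show "(\<lambda>x. \<Sum>k\<in>S n. c k * b k x) \<in> borel_measurable M" for n
      using S(2)[of n] by (intro borel_measurable_sum borel_measurable_times) auto
    show "(\<lambda>n. \<Sum>k\<in>S n. c k * b k x) \<longlonglongrightarrow> f x" if "x \<in> space M" for x
    proof (rule LIM_zero_cancel, rule Lim_null_comparison[OF always_eventually])
      show "\<forall>n. cmod ((\<Sum>k\<in>S n. c k * b k x) - f x) \<le> inverse (real (Suc n))"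
        using approx[OF that] by (simp add: norm_minus_commute)
    qed (rule LIMSEQ_inverse_real_of_nat)
  qed
qed

lemma integrable_basis_product:
  assumes bound: "\<And>k x. k \<in> I \<Longrightarrow> x \<in> space M \<Longrightarrow> cmod (b k x) \<le> K"
    and "k \<in> I" "l \<in> I"
  shows "integrable M (\<lambda>x. b k x * cnj (b l x))"
proof (rule integrable_const_bound[where B = "K * K"])
  have "0 \<le> K" if "x \<in> space M" for x
    using bound[OF \<open>k \<in> I\<close> that] norm_ge_zero order_trans by blast
  then show "AE x in M. cmod (b k x * cnj (b l x)) \<le> K * K"
    using assms by (intro AE_I2) (auto simp: norm_mult intro!: mult_mono)
  have [measurable]: "cnj \<in> borel_measurable borel"
    by (intro borel_measurable_continuous_onI continuous_intros)
  show "(\<lambda>x. b k x * cnj (b l x)) \<in> borel_measurable M"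
    using assms by measurable
qed

text \<open>
  For a finite partial sum the claim is orthonormality, and both sides change by an arbitrarily
  small amount when \<open>f\<close> is replaced by a partial sum that contains the index \<open>k\<close> and is uniformly
  close to \<open>f\<close>.
\<close>

lemma wiener_coefficient:
  assumes f: "wiener_expansion M I b c f"
    and bound: "\<And>k x. k \<in> I \<Longrightarrow> x \<in> space M \<Longrightarrow> cmod (b k x) \<le> K"
    and "0 < K" and k: "k \<in> I"
  shows "L2_inner M f (b k) = c k"
proof -
  have [measurable]: "cnj \<in> borel_measurable borel"
    by (intro borel_measurable_continuous_onI continuous_intros)
  have [measurable]: "f \<in> borel_measurable M" "b k \<in> borel_measurable M"
    using wiener_measurable[OF f bound \<open>0 < K\<close>] k by auto
  have "cmod (L2_inner M f (b k) - c k) \<le> \<delta>" if "\<delta> > 0" for \<delta>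
  proof -
    have pos: "\<delta> / K > 0" using \<open>\<delta> > 0\<close> \<open>0 < K\<close> by simp
    obtain S where S: "finite S" "{k} \<subseteq> S" "S \<subseteq> I"
      and approx: "\<And>x. x \<in> space M \<Longrightarrow> cmod (f x - (\<Sum>j\<in>S. c j * b j x)) \<le> \<delta> / K"
      using wiener_uniform_approx[OF f bound \<open>0 < K\<close> pos, of "{k}"] k by blast
    define g where "g x = (\<Sum>j\<in>S. c j * b j x)" for x
    have [measurable]: "g \<in> borel_measurable M"
      unfolding g_def using S(3) by (intro borel_measurable_sum borel_measurable_times) auto
    have gk: "(\<lambda>x. g x * cnj (b k x)) = (\<lambda>x. \<Sum>j\<in>S. c j * (b j x * cnj (b k x)))"
      by (simp add: g_def sum_distrib_right mult.assoc)
    have int: "integrable M (\<lambda>x. c j * (b j x * cnj (b k x)))" if "j \<in> S" for j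
      using integrable_basis_product[OF bound] S k that by (intro integrable_mult_right) auto
    have int_g: "integrable M (\<lambda>x. g x * cnj (b k x))"
      unfolding gk using int by (rule Bochner_Integration.integrable_sum)
    have "expectation (\<lambda>x. g x * cnj (b k x)) = (\<Sum>j\<in>S. c j * L2_inner M (b j) (b k))"
      unfolding gk L2_inner_def using int by (subst Bochner_Integration.integral_sum) auto
    also have "\<dots> = (\<Sum>j\<in>S. if j = k then c j else 0)"
      using S k orthonormal by (intro sum.cong) auto
    also have "\<dots> = c k" using S by simp
    finally have g: "expectation (\<lambda>x. g x * cnj (b k x)) = c k" .
    have small: "cmod ((f x - g x) * cnj (b k x)) \<le> \<delta>" if "x \<in> space M" for x
    proof -
      have "cmod (f x - g x) * cmod (b k x) \<le> \<delta> / K * K"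
        using approx[OF that] bound[OF k that] pos by (intro mult_mono) (auto simp: g_def)
      then show ?thesis using \<open>0 < K\<close> by (simp add: norm_mult)
    qed
    have int_d: "integrable M (\<lambda>x. (f x - g x) * cnj (b k x))"
      using small by (intro integrable_const_bound[where B = \<delta>] AE_I2) auto
    have "L2_inner M f (b k) = expectation (\<lambda>x. (f x - g x) * cnj (b k x) + g x * cnj (b k x))"
      unfolding L2_inner_def by (simp add: algebra_simps)
    also have "\<dots> = expectation (\<lambda>x. (f x - g x) * cnj (b k x)) + c k"
      using int_d int_g g by (subst Bochner_Integration.integral_add) auto
    finally have "cmod (L2_inner M f (b k) - c k)
        = cmod (expectation (\<lambda>x. (f x - g x) * cnj (b k x)))" by simp
    also have "\<dots> \<le> expectation (\<lambda>x. cmod ((f x - g x) * cnj (b k x)))"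
      by (rule integral_norm_bound)
    also have "\<dots> \<le> expectation (\<lambda>_. \<delta>)"
      using small by (intro integral_mono integrable_norm int_d) auto
    finally show ?thesis by (simp add: prob_space)
  qed
  then have "cmod (L2_inner M f (b k) - c k) \<le> 0"
    by (rule field_le_epsilon) simp
  then show ?thesis by simp
qed

lemma unit_ballE:
  assumes "f \<in> wiener_unit_ball M I b"
  obtains c where "wiener_expansion M I b c f" "(\<Sum>\<^sub>\<infinity>k\<in>I. cmod (c k)) \<le> 1"
  using assms wiener_norm_eq by (auto simp: wiener_unit_ball_def wiener_algebra_def)

lemma unit_ball_measurable:
  assumes "f \<in> wiener_unit_ball M I b"
    and bound: "\<And>k x. k \<in> I \<Longrightarrow> x \<in> space M \<Longrightarrow> cmod (b k x) \<le> K" and "0 < K"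
  shows "f \<in> borel_measurable M"
  using assms(1) by (rule unit_ballE) (rule wiener_measurable[OF _ bound \<open>0 < K\<close>])

lemma unit_ball_cmod_le:
  assumes f: "f \<in> wiener_unit_ball M I b"
    and bound: "\<And>k x. k \<in> I \<Longrightarrow> x \<in> space M \<Longrightarrow> cmod (b k x) \<le> K" and "0 < K"
    and x: "x \<in> space M"
  shows "cmod (f x) \<le> K"
proof -
  obtain c where c: "wiener_expansion M I b c f" "(\<Sum>\<^sub>\<infinity>k\<in>I. cmod (c k)) \<le> 1"
    using f by (rule unit_ballE)
  \<comment> \<open>the whole function is the remainder after the empty partial sum\<close>
  have "cmod (f x - (\<Sum>k\<in>{}. c k * b k x)) \<le> ((\<Sum>\<^sub>\<infinity>k\<in>I. cmod (c k)) - (\<Sum>k\<in>{}. cmod (c k))) * K"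
    using c(1) x by (intro wiener_remainder_le) (auto intro!: bound)
  also have "\<dots> \<le> 1 * K" using c(2) \<open>0 < K\<close> by (intro mult_right_mono) auto
  finally show ?thesis by simp
qed

lemma unit_ball_coefficients_le:
  assumes f: "f \<in> wiener_unit_ball M I b"
    and bound: "\<And>k x. k \<in> I \<Longrightarrow> x \<in> space M \<Longrightarrow> cmod (b k x) \<le> K" and "0 < K"
    and "finite \<Lambda>" "\<Lambda> \<subseteq> I"
  shows "(\<Sum>k\<in>\<Lambda>. cmod (L2_inner M f (b k))) \<le> 1"
proof -
  obtain c where c: "wiener_expansion M I b c f" "(\<Sum>\<^sub>\<infinity>k\<in>I. cmod (c k)) \<le> 1"
    using f by (rule unit_ballE)
  have "(\<Sum>k\<in>\<Lambda>. cmod (L2_inner M f (b k))) = (\<Sum>k\<in>\<Lambda>. cmod (c k))"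
    using wiener_coefficient[OF c(1) bound \<open>0 < K\<close>] \<open>\<Lambda> \<subseteq> I\<close> by (intro sum.cong) auto
  also have "\<dots> \<le> (\<Sum>\<^sub>\<infinity>k\<in>I. cmod (c k))"
    using c(1) \<open>finite \<Lambda>\<close> \<open>\<Lambda> \<subseteq> I\<close>
    by (intro finite_sum_le_infsum) (auto simp: wiener_expansion_def)
  finally show ?thesis using c(2) by simp
qed

end

section \<open>From second moments to the $L_p$ norm\<close>

text \<open>
  The values of \<open>cmod w\<close> up to \<open>\<epsilon> / 2\<close> contribute at most half of \<open>\<epsilon> powr p\<close> to the integral of
  \<open>cmod w powr p\<close>. The larger ones are at most \<open>R\<close> and, by Chebyshev's inequality, occur on a set of
  small measure. The argument treats \<open>p < 2\<close> and \<open>p > 2\<close> alike, at the price of a power of \<open>\<epsilon>\<close> that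
  is not optimal.
\<close>

lemma (in prob_space) Lp_norm_le_of_second_moment:
  fixes w :: "'a \<Rightarrow> complex"
  assumes w [measurable]: "w \<in> borel_measurable M"
    and bound: "\<And>x. x \<in> space M \<Longrightarrow> cmod (w x) \<le> R"
    and "0 < R" "0 < \<epsilon>" "1 \<le> p"
    and moment: "8 * R powr p * expectation (\<lambda>x. (cmod (w x))\<^sup>2) \<le> \<epsilon> powr (p + 2)"
  shows "Lp_norm M p w \<le> ennreal \<epsilon>"
proof -
  define \<eta> where "\<eta> = \<epsilon> / 2"
  have "0 < \<eta>" using \<open>0 < \<epsilon>\<close> by (simp add: \<eta>_def)
  have int: "integrable M (\<lambda>x. cmod (w x) powr p)"
    using bound \<open>1 \<le> p\<close>
    by (intro integrable_const_bound[where B = "R powr p"] AE_I2) (auto intro!: powr_mono2)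
  have int2: "integrable M (\<lambda>x. (cmod (w x))\<^sup>2)"
    using bound
    by (intro integrable_const_bound[where B = "R\<^sup>2"] AE_I2) (auto intro!: power_mono)
  have pointwise: "cmod (w x) powr p \<le> \<eta> powr p + R powr p / \<eta>\<^sup>2 * (cmod (w x))\<^sup>2"
    if x: "x \<in> space M" for x
  proof (cases "cmod (w x) \<le> \<eta>")
    case True
    then have "cmod (w x) powr p \<le> \<eta> powr p"
      using \<open>1 \<le> p\<close> by (intro powr_mono2) auto
    moreover have "0 \<le> R powr p / \<eta>\<^sup>2 * (cmod (w x))\<^sup>2"
      by simp
    ultimately show ?thesis by linarith
  next
    case False
    then have "1 \<le> (cmod (w x))\<^sup>2 / \<eta>\<^sup>2"
      using \<open>0 < \<eta>\<close> by (simp add: power_mono)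
    then have "R powr p * 1 \<le> R powr p * ((cmod (w x))\<^sup>2 / \<eta>\<^sup>2)"
      by (intro mult_left_mono) auto
    moreover have "cmod (w x) powr p \<le> R powr p"
      using bound[OF x] \<open>1 \<le> p\<close> by (intro powr_mono2) auto
    moreover have "0 \<le> \<eta> powr p" by simp
    ultimately show ?thesis unfolding mult_1_right times_divide_eq_right times_divide_eq_left
      by linarith
  qed
  have "expectation (\<lambda>x. cmod (w x) powr p)
      \<le> expectation (\<lambda>x. \<eta> powr p + R powr p / \<eta>\<^sup>2 * (cmod (w x))\<^sup>2)"
    using pointwise by (intro integral_mono int Bochner_Integration.integrable_add
        integrable_mult_right int2) auto
  also have "\<dots> = \<eta> powr p + R powr p / \<eta>\<^sup>2 * expectation (\<lambda>x. (cmod (w x))\<^sup>2)"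
    using int2 by (subst Bochner_Integration.integral_add) (auto simp: prob_space)
  also have "\<eta> powr p \<le> \<epsilon> powr p / 2"
  proof -
    have "\<eta> powr p = \<epsilon> powr p / 2 powr p"
      using \<open>0 < \<epsilon>\<close> by (simp add: \<eta>_def powr_divide)
    also have "\<dots> \<le> \<epsilon> powr p / 2 powr 1"
      using \<open>1 \<le> p\<close> by (intro divide_left_mono powr_mono) auto
    finally show ?thesis by simp
  qed
  also have "R powr p / \<eta>\<^sup>2 * expectation (\<lambda>x. (cmod (w x))\<^sup>2) \<le> \<epsilon> powr p / 2"
  proof -
    have "\<epsilon> powr (p + 2) = \<epsilon> powr p * \<epsilon>\<^sup>2"
      using \<open>0 < \<epsilon>\<close> by (simp add: powr_add)
    with moment have "8 * R powr p * expectation (\<lambda>x. (cmod (w x))\<^sup>2) \<le> \<epsilon> powr p * \<epsilon>\<^sup>2"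
      by simp
    then show ?thesis
      using \<open>0 < \<epsilon>\<close> by (simp add: \<eta>_def field_simps)
  qed
  finally have "expectation (\<lambda>x. cmod (w x) powr p) \<le> \<epsilon> powr p"
    by simp
  then have "expectation (\<lambda>x. cmod (w x) powr p) powr (1 / p) \<le> (\<epsilon> powr p) powr (1 / p)"
    using \<open>1 \<le> p\<close> by (intro powr_mono2) auto
  then have "expectation (\<lambda>x. cmod (w x) powr p) powr (1 / p) \<le> \<epsilon>"
    using \<open>1 \<le> p\<close> \<open>0 < \<epsilon>\<close> by (simp add: powr_powr)
  then show ?thesis
    using int by (simp add: Lp_norm_def Lp_space_def ennreal_leI)
qed

lemma (in prob_space) bounded_in_Lp_space:
  fixes w :: "'a \<Rightarrow> complex"
  assumes [measurable]: "w \<in> borel_measurable M"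
    and bound: "\<And>x. x \<in> space M \<Longrightarrow> cmod (w x) \<le> R" and "0 \<le> p"
  shows "w \<in> Lp_space M p"
proof -
  have "integrable M (\<lambda>x. cmod (w x) powr p)"
    using bound \<open>0 \<le> p\<close>
    by (intro integrable_const_bound[where B = "R powr p"] AE_I2) (auto intro!: powr_mono2)
  then show ?thesis by (simp add: Lp_space_def)
qed

lemma (in prob_space) Lp_norm_le_sup:
  fixes w :: "'a \<Rightarrow> complex"
  assumes [measurable]: "w \<in> borel_measurable M"
    and bound: "\<And>x. x \<in> space M \<Longrightarrow> cmod (w x) \<le> R" and "0 < R" "1 \<le> p"
  shows "Lp_norm M p w \<le> ennreal R"
proof -
  have mem: "w \<in> Lp_space M p"
    using assms by (intro bounded_in_Lp_space) auto
  then have "expectation (\<lambda>x. cmod (w x) powr p) \<le> expectation (\<lambda>_. R powr p)"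
    using bound \<open>1 \<le> p\<close> by (intro integral_mono) (auto simp: Lp_space_def intro!: powr_mono2)
  then have "expectation (\<lambda>x. cmod (w x) powr p) powr (1 / p) \<le> (R powr p) powr (1 / p)"
    using \<open>1 \<le> p\<close> by (intro powr_mono2) (auto simp: prob_space)
  then have "expectation (\<lambda>x. cmod (w x) powr p) powr (1 / p) \<le> R"
    using \<open>1 \<le> p\<close> \<open>0 < R\<close> by (simp add: powr_powr)
  with mem show ?thesis by (simp add: Lp_norm_def ennreal_leI)
qed

section \<open>Recovery from samples\<close>

context bounded_orthonormal_system
begin

text \<open>
  The square of \<open>cmod h\<close> is a quadratic form in the coefficients \<open>e\<close>, and the error of its sample sum
  is the same form with \<open>b k * cnj (b l)\<close> replaced by the deviation of its sample sum. The bound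
  is independent of \<open>card \<Lambda>\<close> because the absolute values of the products
  \<open>e k * cnj (e l)\<close> add up to the square of the coefficient sum.
\<close>

lemma combination_L2_le_sample_sum:
  fixes s t :: real
  assumes bound: "\<And>k x. k \<in> I \<Longrightarrow> x \<in> space M \<Longrightarrow> cmod (b k x) \<le> K"
    and \<Lambda>: "finite \<Lambda>" "\<Lambda> \<subseteq> I"
    and gram: "\<And>k l. k \<in> \<Lambda> \<Longrightarrow> l \<in> \<Lambda> \<Longrightarrow>
       cmod (\<Sum>x\<leftarrow>xs. b k x * cnj (b l x) - L2_inner M (b k) (b l)) \<le> length xs * t"
    and e: "(\<Sum>k\<in>\<Lambda>. cmod (e k)) \<le> s" and "0 \<le> t"
  shows "length xs * expectation (\<lambda>x. (cmod (\<Sum>k\<in>\<Lambda>. e k * b k x))\<^sup>2)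
           \<le> (\<Sum>x\<leftarrow>xs. (cmod (\<Sum>k\<in>\<Lambda>. e k * b k x))\<^sup>2) + length xs * (s\<^sup>2 * t)"
proof -
  define h where "h x = (\<Sum>k\<in>\<Lambda>. e k * b k x)" for x
  define E where "E = expectation (\<lambda>x. (cmod (h x))\<^sup>2)"
  define q where "q = (\<lambda>(k, l) x. b k x * cnj (b l x))"
  define w where "w = (\<lambda>(k, l). e k * cnj (e l))"
  have sq: "complex_of_real ((cmod (h x))\<^sup>2) = (\<Sum>p\<in>\<Lambda> \<times> \<Lambda>. w p * q p x)" for x
    by (simp add: complex_norm_square h_def sum_product sum.cartesian_product w_def q_def
        case_prod_unfold mult_ac del: of_real_power)
  have int: "integrable M (\<lambda>x. w p * q p x)" if "p \<in> \<Lambda> \<times> \<Lambda>" for p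
    using that \<Lambda>(2) integrable_basis_product[OF bound] unfolding q_def
    by (intro integrable_mult_right) auto
  have "complex_of_real E = expectation (\<lambda>x. complex_of_real ((cmod (h x))\<^sup>2))"
    unfolding E_def by (rule integral_complex_of_real[symmetric])
  also have "\<dots> = (\<Sum>p\<in>\<Lambda> \<times> \<Lambda>. w p * expectation (q p))"
    unfolding sq using int by (subst Bochner_Integration.integral_sum) auto
  finally have E: "complex_of_real E = (\<Sum>p\<in>\<Lambda> \<times> \<Lambda>. w p * expectation (q p))" .
  have dev: "complex_of_real ((cmod (h x))\<^sup>2 - E)
      = (\<Sum>p\<in>\<Lambda> \<times> \<Lambda>. w p * (q p x - expectation (q p)))" for x
    by (simp only: of_real_diff sq E right_diff_distrib sum_subtractf)
  have "(\<Sum>x\<leftarrow>xs. (cmod (h x))\<^sup>2) - length xs * E = (\<Sum>x\<leftarrow>xs. (cmod (h x))\<^sup>2 - E)"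
    by (induction xs) (simp_all add: algebra_simps)
  then have "complex_of_real ((\<Sum>x\<leftarrow>xs. (cmod (h x))\<^sup>2) - length xs * E)
      = complex_of_real (\<Sum>x\<leftarrow>xs. (cmod (h x))\<^sup>2 - E)"
    by (simp only:)
  also have "\<dots> = (\<Sum>x\<leftarrow>xs. \<Sum>p\<in>\<Lambda> \<times> \<Lambda>. w p * (q p x - expectation (q p)))"
    by (induction xs) (simp_all only: list.map sum_list.Nil sum_list.Cons of_real_0 of_real_add dev)
  also have "\<dots> = (\<Sum>p\<in>\<Lambda> \<times> \<Lambda>. w p * (\<Sum>x\<leftarrow>xs. q p x - expectation (q p)))"
    by (induction xs) (simp_all add: sum.distrib distrib_left)
  finally have total: "complex_of_real ((\<Sum>x\<leftarrow>xs. (cmod (h x))\<^sup>2) - length xs * E)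
      = (\<Sum>p\<in>\<Lambda> \<times> \<Lambda>. w p * (\<Sum>x\<leftarrow>xs. q p x - expectation (q p)))" .
  have "\<bar>(\<Sum>x\<leftarrow>xs. (cmod (h x))\<^sup>2) - length xs * E\<bar>
      = cmod (\<Sum>p\<in>\<Lambda> \<times> \<Lambda>. w p * (\<Sum>x\<leftarrow>xs. q p x - expectation (q p)))"
    unfolding total[symmetric] by (rule norm_of_real[symmetric])
  also have "\<dots> \<le> (\<Sum>p\<in>\<Lambda> \<times> \<Lambda>. cmod (w p) * (length xs * t))"
    using gram unfolding L2_inner_def q_def
    by (intro sum_norm_le) (auto simp: norm_mult intro!: mult_left_mono)
  also have "\<dots> = (\<Sum>k\<in>\<Lambda>. cmod (e k))\<^sup>2 * (length xs * t)"
    by (simp only: power2_eq_square sum_product sum.cartesian_product flip: sum_distrib_right)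
       (simp add: w_def norm_mult case_prod_unfold)
  also have "\<dots> \<le> s\<^sup>2 * (length xs * t)"
    using e \<open>0 \<le> t\<close> by (intro mult_right_mono power_mono) (auto intro!: sum_nonneg)
  finally show ?thesis
    unfolding E_def h_def by (simp add: algebra_simps abs_le_iff)
qed

lemma exists_good_sampling_points:
  fixes t :: real
  assumes bound: "\<And>k x. k \<in> I \<Longrightarrow> x \<in> space M \<Longrightarrow> cmod (b k x) \<le> K"
    and "0 < K" and \<Lambda>: "finite \<Lambda>" "\<Lambda> \<subseteq> I" and "0 < t"
    and card: "4 * (real (card \<Lambda>))\<^sup>2 \<le> exp (n * t\<^sup>2 / (8 * K ^ 4))"
  shows "\<exists>xs. length xs = n \<and> set xs \<subseteq> space M \<and>
     (\<forall>k\<in>\<Lambda>. \<forall>l\<in>\<Lambda>.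
        cmod (\<Sum>x\<leftarrow>xs. b k x * cnj (b l x) - L2_inner M (b k) (b l)) \<le> n * t)"
proof -
  define u where "u = (\<lambda>(k, l) x. b k x * cnj (b l x))"
  have "\<exists>xs. length xs = n \<and> set xs \<subseteq> space M \<and>
          (\<forall>p\<in>\<Lambda> \<times> \<Lambda>. cmod (\<Sum>x\<leftarrow>xs. u p x - expectation (u p)) \<le> n * t)"
  proof (rule exists_points_mean_approx[where K = "K\<^sup>2"])
    show "u p \<in> borel_measurable M" if "p \<in> \<Lambda> \<times> \<Lambda>" for p
      using that \<Lambda>(2)
      by (auto simp: u_def intro!: borel_measurable_integrable[OF integrable_basis_product[OF bound]])
    show "cmod (u p x) \<le> K\<^sup>2" if "p \<in> \<Lambda> \<times> \<Lambda>" "x \<in> space M" for p x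
    proof -
      have "cmod (b k x) \<le> K" if "k \<in> \<Lambda>" for k
        using that \<Lambda>(2) bound \<open>x \<in> space M\<close> by blast
      then show ?thesis
        using that(1) \<open>0 < K\<close> by (auto simp: u_def norm_mult power2_eq_square intro!: mult_mono)
    qed
    show "real (4 * card (\<Lambda> \<times> \<Lambda>)) \<le> exp (n * t\<^sup>2 / (8 * (K\<^sup>2)\<^sup>2))"
      using card by (simp add: card_cartesian_product power2_eq_square power4_eq_xxxx mult_ac)
  qed (use \<Lambda> \<open>0 < K\<close> \<open>0 < t\<close> in auto)
  then show ?thesis
    by (auto simp: u_def L2_inner_def)
qed

text \<open>
  The map selects coefficients in the \<open>\<ell>\<^sub>1\<close> ball that reproduce the data up to \<open>\<delta>\<close>. The difference
  \<open>h\<close> between the projection of \<open>f\<close> and the selected function lies in twice that ball, so with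
  \<open>t = \<delta>\<^sup>2\<close> its second moment is at most \<open>4 * \<delta>\<^sup>2\<close> from the sample plus \<open>2\<^sup>2 * \<delta>\<^sup>2\<close> from the
  sampling error. Adding the projection error gives \<open>2 * \<delta>\<^sup>2 + 2 * (8 * \<delta>\<^sup>2) = 18 * \<delta>\<^sup>2\<close>.
\<close>

lemma exists_recovery_map:
  assumes bound: "\<And>k x. k \<in> I \<Longrightarrow> x \<in> space M \<Longrightarrow> cmod (b k x) \<le> K"
    and "0 < K" and F: "F \<subseteq> wiener_unit_ball M I b"
    and \<Lambda>: "finite \<Lambda>" "\<Lambda> \<subseteq> I" and "0 < \<delta>"
    and proj: "\<And>f x. f \<in> F \<Longrightarrow> x \<in> space M \<Longrightarrow> cmod (f x - projection M b \<Lambda> f x) \<le> \<delta>"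
    and "0 < n" and card: "4 * (real (card \<Lambda>))\<^sup>2 \<le> exp (n * (\<delta>\<^sup>2)\<^sup>2 / (8 * K ^ 4))"
  shows "\<exists>xs \<phi>. length xs = n \<and> set xs \<subseteq> space M \<and>
     (\<forall>ys. \<phi> ys \<in> borel_measurable M \<and> (\<forall>x\<in>space M. cmod (\<phi> ys x) \<le> K)) \<and>
     (\<forall>f\<in>F. expectation (\<lambda>x. (cmod (f x - \<phi> (map f xs) x))\<^sup>2) \<le> 18 * \<delta>\<^sup>2)"
proof -
  have "0 < \<delta>\<^sup>2" using \<open>0 < \<delta>\<close> by simp
  from exists_good_sampling_points[OF bound \<open>0 < K\<close> \<Lambda> this card]
  obtain xs where xs: "length xs = n" "set xs \<subseteq> space M"
    and gram: "\<And>k l. k \<in> \<Lambda> \<Longrightarrow> l \<in> \<Lambda> \<Longrightarrow>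
        cmod (\<Sum>x\<leftarrow>xs. b k x * cnj (b l x) - L2_inner M (b k) (b l)) \<le> n * \<delta>\<^sup>2"
    by blast
  define feasible where "feasible ys e \<longleftrightarrow> (\<Sum>k\<in>\<Lambda>. cmod (e k)) \<le> 1 \<and>
      list_all2 (\<lambda>x y. cmod ((\<Sum>k\<in>\<Lambda>. e k * b k x) - y) \<le> \<delta>) xs ys" for ys e
  define choice where "choice ys =
      (if \<exists>e. feasible ys e then SOME e. feasible ys e else (\<lambda>_. 0))" for ys
  define \<phi> where "\<phi> ys x = (\<Sum>k\<in>\<Lambda>. choice ys k * b k x)" for ys x
  have choice: "(\<Sum>k\<in>\<Lambda>. cmod (choice ys k)) \<le> 1" for ys
  proof (cases "\<exists>e. feasible ys e")
    case True
    then have "feasible ys (choice ys)"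
      using someI_ex[of "feasible ys"] by (simp add: choice_def)
    then show ?thesis by (simp add: feasible_def)
  qed (simp add: choice_def)
  have \<phi>_meas: "\<phi> ys \<in> borel_measurable M" for ys
    unfolding \<phi>_def using \<Lambda>(2) by (intro borel_measurable_sum borel_measurable_times) auto
  have \<phi>_le: "cmod (\<phi> ys x) \<le> K" if "x \<in> space M" for ys x
    using cmod_combination_le[OF _ choice, of x K ys] that \<Lambda>(2) bound \<open>0 < K\<close>
    by (auto simp: \<phi>_def)
  have error: "expectation (\<lambda>x. (cmod (f x - \<phi> (map f xs) x))\<^sup>2) \<le> 18 * \<delta>\<^sup>2" if f: "f \<in> F" for f
  proof -
    have ball: "f \<in> wiener_unit_ball M I b" using f F by blast
    note [measurable] = unit_ball_measurable[OF ball bound \<open>0 < K\<close>] \<phi>_meas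
    define a where "a k = L2_inner M f (b k)" for k
    define e where "e = choice (map f xs)"
    have Pf: "projection M b \<Lambda> f x = (\<Sum>k\<in>\<Lambda>. a k * b k x)" for x
      by (simp add: projection_def a_def)
    have a: "(\<Sum>k\<in>\<Lambda>. cmod (a k)) \<le> 1"
      unfolding a_def by (rule unit_ball_coefficients_le[OF ball bound \<open>0 < K\<close> \<Lambda>])
    \<comment> \<open>the selection from the data of \<open>f\<close> does not fall back to its default value\<close>
    have "feasible (map f xs) a"
      using a proj[OF f] xs(2)
      by (auto simp: feasible_def list_all2_map2 list_all2_same norm_minus_commute simp flip: Pf)
    then have "feasible (map f xs) e"
      using someI[of "feasible (map f xs)" a] by (auto simp: e_def choice_def)
    then have e: "(\<Sum>k\<in>\<Lambda>. cmod (e k)) \<le> 1"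
      and fit: "\<And>x. x \<in> set xs \<Longrightarrow> cmod ((\<Sum>k\<in>\<Lambda>. e k * b k x) - f x) \<le> \<delta>"
      by (auto simp: feasible_def list_all2_map2 list_all2_same)
    define h where "h x = (\<Sum>k\<in>\<Lambda>. (a k - e k) * b k x)" for x
    have h: "h x = projection M b \<Lambda> f x - \<phi> (map f xs) x" for x
      by (simp add: h_def Pf \<phi>_def e_def left_diff_distrib sum_subtractf)
    have ae: "(\<Sum>k\<in>\<Lambda>. cmod (a k - e k)) \<le> 2"
    proof -
      have "(\<Sum>k\<in>\<Lambda>. cmod (a k - e k)) \<le> (\<Sum>k\<in>\<Lambda>. cmod (a k) + cmod (e k))"
        by (intro sum_mono norm_triangle_ineq4)
      with a e show ?thesis by (simp add: sum.distrib)
    qed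
    have h_meas [measurable]: "h \<in> borel_measurable M"
      unfolding h_def using \<Lambda>(2) by (intro borel_measurable_sum borel_measurable_times) auto
    have h_le: "cmod (h x) \<le> 2 * K" if "x \<in> space M" for x
      unfolding h_def using \<Lambda>(2) bound that \<open>0 < K\<close> by (intro cmod_combination_le[OF _ ae]) auto
    have h_fit: "(cmod (h x))\<^sup>2 \<le> 4 * \<delta>\<^sup>2" if "x \<in> set xs" for x
    proof -
      have "\<phi> (map f xs) x - f x = (\<Sum>k\<in>\<Lambda>. e k * b k x) - f x"
        by (simp add: \<phi>_def e_def)
      then have "cmod (\<phi> (map f xs) x - f x) \<le> \<delta>"
        using fit[OF that] by simp
      moreover have "cmod (f x - projection M b \<Lambda> f x) \<le> \<delta>"
        using that xs(2) by (intro proj[OF f]) auto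
      moreover have "h x = - ((f x - projection M b \<Lambda> f x) + (\<phi> (map f xs) x - f x))"
        by (simp add: h)
      ultimately have "cmod (h x) \<le> 2 * \<delta>"
        using norm_triangle_ineq[of "f x - projection M b \<Lambda> f x" "\<phi> (map f xs) x - f x"]
        by (simp only: norm_minus_cancel)
      then have "(cmod (h x))\<^sup>2 \<le> (2 * \<delta>)\<^sup>2" by (intro power_mono) auto
      then show ?thesis by (simp add: power_mult_distrib)
    qed
    have "n * expectation (\<lambda>x. (cmod (h x))\<^sup>2)
        \<le> (\<Sum>x\<leftarrow>xs. (cmod (h x))\<^sup>2) + n * (2\<^sup>2 * \<delta>\<^sup>2)"
      unfolding h_def xs(1)[symmetric]
      using combination_L2_le_sample_sum[OF bound \<Lambda> _ ae, of xs "\<delta>\<^sup>2"] gram xs(1) by simp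
    also have "(\<Sum>x\<leftarrow>xs. (cmod (h x))\<^sup>2) \<le> (\<Sum>x\<leftarrow>xs. 4 * \<delta>\<^sup>2)"
      using h_fit by (rule sum_list_mono)
    finally have "n * expectation (\<lambda>x. (cmod (h x))\<^sup>2) \<le> n * (8 * \<delta>\<^sup>2)"
      by (simp add: xs(1) sum_list_triv)
    then have L2: "expectation (\<lambda>x. (cmod (h x))\<^sup>2) \<le> 8 * \<delta>\<^sup>2"
      using \<open>0 < n\<close> by simp
    have int_h: "integrable M (\<lambda>x. (cmod (h x))\<^sup>2)"
      using power_mono[OF h_le, of _ 2]
      by (intro integrable_const_bound[where B = "(2 * K)\<^sup>2"] AE_I2) auto
    have pointwise: "(cmod (f x - \<phi> (map f xs) x))\<^sup>2 \<le> 2 * \<delta>\<^sup>2 + 2 * (cmod (h x))\<^sup>2"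
      if "x \<in> space M" for x
    proof -
      have "cmod (f x - \<phi> (map f xs) x) \<le> cmod (f x - projection M b \<Lambda> f x) + cmod (h x)"
        using norm_triangle_ineq[of "f x - projection M b \<Lambda> f x" "h x"] by (simp add: h)
      also have "\<dots> \<le> \<delta> + cmod (h x)" using proj[OF f that] by simp
      finally have "(cmod (f x - \<phi> (map f xs) x))\<^sup>2 \<le> (\<delta> + cmod (h x))\<^sup>2"
        by (intro power_mono) auto
      also have "\<dots> \<le> 2 * \<delta>\<^sup>2 + 2 * (cmod (h x))\<^sup>2"
        using sum_squares_bound[of \<delta> "cmod (h x)"] by (simp add: power2_sum)
      finally show ?thesis .
    qed
    have int_err: "integrable M (\<lambda>x. (cmod (f x - \<phi> (map f xs) x))\<^sup>2)"
    proof (rule Bochner_Integration.integrable_bound)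
      show "integrable M (\<lambda>x. 2 * \<delta>\<^sup>2 + 2 * (cmod (h x))\<^sup>2)"
        using int_h by simp
      show "AE x in M. norm ((cmod (f x - \<phi> (map f xs) x))\<^sup>2)
          \<le> norm (2 * \<delta>\<^sup>2 + 2 * (cmod (h x))\<^sup>2)"
        using pointwise by (intro AE_I2) simp
    qed simp
    have "expectation (\<lambda>x. (cmod (f x - \<phi> (map f xs) x))\<^sup>2)
        \<le> expectation (\<lambda>x. 2 * \<delta>\<^sup>2 + 2 * (cmod (h x))\<^sup>2)"
      using pointwise int_h by (intro integral_mono int_err) auto
    also have "\<dots> = 2 * \<delta>\<^sup>2 + 2 * expectation (\<lambda>x. (cmod (h x))\<^sup>2)"
      using int_h by (subst Bochner_Integration.integral_add) (auto simp: prob_space)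
    finally show ?thesis using L2 by simp
  qed
  show ?thesis
    using xs \<phi>_meas \<phi>_le error by (intro exI[of _ xs] exI[of _ \<phi>]) auto
qed

end

section \<open>Sampling complexity\<close>

lemma sampling_complexity_le:
  assumes "length xs = n" "set xs \<subseteq> space M" "\<And>ys. \<phi> ys \<in> Lp_space M p"
    and "\<And>f. f \<in> F \<Longrightarrow> Lp_norm M p (\<lambda>x. f x - \<phi> (map f xs) x) \<le> ennreal \<epsilon>"
  shows "sampling_complexity M \<epsilon> F p \<le> enat n"
  unfolding sampling_complexity_def
  using assms by (intro Inf_lower CollectI exI[of _ n] exI[of _ xs] exI[of _ \<phi>] conjI refl)
    (auto intro!: SUP_least)

context bounded_orthonormal_system
begin

text \<open>
  The constant 144 is the product of the 8 in the passage from the second moment to the \<open>L\<^sub>p\<close> norm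
  and the 18 in the error of the recovery map.
\<close>

lemma sampling_complexity_le_of_projection:
  assumes bound: "system_bound M I b \<le> ennreal K" and "0 < K"
    and F: "F \<subseteq> wiener_unit_ball M I b"
    and \<Lambda>: "finite \<Lambda>" "\<Lambda> \<subseteq> I" "projection_error M b \<Lambda> F \<le> ennreal \<delta>" and "0 < \<delta>"
    and n: "0 < n" "4 * (real (card \<Lambda>))\<^sup>2 \<le> exp (n * (\<delta>\<^sup>2)\<^sup>2 / (8 * K ^ 4))"
    and "1 \<le> p" "0 < \<epsilon>" and \<delta>: "144 * (2 * K) powr p * \<delta>\<^sup>2 \<le> \<epsilon> powr (p + 2)"
  shows "sampling_complexity M \<epsilon> F p \<le> enat n"
proof -
  note b = cmod_basis_le[OF bound less_imp_le[OF \<open>0 < K\<close>]]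
  have proj: "cmod (f x - projection M b \<Lambda> f x) \<le> \<delta>" if "f \<in> F" "x \<in> space M" for f x
  proof -
    have "ennreal (cmod (f x - projection M b \<Lambda> f x))
        \<le> sup_norm (space M) (\<lambda>x. f x - projection M b \<Lambda> f x)"
      unfolding sup_norm_def using that by (intro SUP_upper)
    also have "\<dots> \<le> projection_error M b \<Lambda> F"
      unfolding projection_error_def using that by (intro SUP_upper)
    also have "\<dots> \<le> ennreal \<delta>" by (rule \<Lambda>)
    finally show ?thesis using \<open>0 < \<delta>\<close> by simp
  qed
  obtain xs \<phi> where xs: "length xs = n" "set xs \<subseteq> space M"
    and \<phi>: "\<And>ys. \<phi> ys \<in> borel_measurable M" "\<And>ys x. x \<in> space M \<Longrightarrow> cmod (\<phi> ys x) \<le> K"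
    and error: "\<And>f. f \<in> F \<Longrightarrow> expectation (\<lambda>x. (cmod (f x - \<phi> (map f xs) x))\<^sup>2) \<le> 18 * \<delta>\<^sup>2"
    using exists_recovery_map[OF b \<open>0 < K\<close> F \<Lambda>(1,2) \<open>0 < \<delta>\<close> proj n] by blast
  show ?thesis
  proof (rule sampling_complexity_le[OF xs])
    show "\<phi> ys \<in> Lp_space M p" for ys
      using \<phi> \<open>1 \<le> p\<close> by (intro bounded_in_Lp_space) auto
    show "Lp_norm M p (\<lambda>x. f x - \<phi> (map f xs) x) \<le> ennreal \<epsilon>" if f: "f \<in> F" for f
    proof (rule Lp_norm_le_of_second_moment[where R = "2 * K"])
      have ball: "f \<in> wiener_unit_ball M I b" using f F by blast
      show "(\<lambda>x. f x - \<phi> (map f xs) x) \<in> borel_measurable M"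
        using unit_ball_measurable[OF ball b \<open>0 < K\<close>] \<phi>(1) by (rule borel_measurable_diff)
      show "cmod (f x - \<phi> (map f xs) x) \<le> 2 * K" if x: "x \<in> space M" for x
        using norm_triangle_ineq4[of "f x" "\<phi> (map f xs) x"]
          unit_ball_cmod_le[OF ball b \<open>0 < K\<close> x] \<phi>(2)[OF x, of "map f xs"] by linarith
      have "8 * (2 * K) powr p * expectation (\<lambda>x. (cmod (f x - \<phi> (map f xs) x))\<^sup>2)
          \<le> 8 * (2 * K) powr p * (18 * \<delta>\<^sup>2)"
        using error[OF f] by (intro mult_left_mono) auto
      also have "\<dots> = 144 * (2 * K) powr p * \<delta>\<^sup>2" by simp
      also note \<delta>
      finally show "8 * (2 * K) powr p * expectation (\<lambda>x. (cmod (f x - \<phi> (map f xs) x))\<^sup>2)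
          \<le> \<epsilon> powr (p + 2)" .
    qed (use \<open>0 < K\<close> \<open>0 < \<epsilon>\<close> \<open>1 \<le> p\<close> in auto)
  qed
qed

text \<open>
  The supremum norm is at most \<open>K\<close> times the Wiener norm, so the zero function approximates every
  \<open>f\<close> in the unit ball up to \<open>K\<close>. Polynomial tractability demands this vanishing for large \<open>\<epsilon>\<close>,
  since \<open>\<epsilon> powr (- r)\<close> tends to 0 for positive \<open>r\<close>.
\<close>

lemma sampling_complexity_eq_0:
  assumes bound: "system_bound M I b \<le> ennreal K" and "0 < K"
    and F: "F \<subseteq> wiener_unit_ball M I b" and "1 \<le> p" "K \<le> \<epsilon>"
  shows "sampling_complexity M \<epsilon> F p = 0"
proof -
  note b = cmod_basis_le[OF bound less_imp_le[OF \<open>0 < K\<close>]]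
  have "sampling_complexity M \<epsilon> F p \<le> enat 0"
  proof (rule sampling_complexity_le[where xs = "[]" and \<phi> = "\<lambda>_ _. 0"])
    show "Lp_norm M p (\<lambda>x. f x - 0) \<le> ennreal \<epsilon>" if "f \<in> F" for f
    proof -
      have ball: "f \<in> wiener_unit_ball M I b" using that F by blast
      have "Lp_norm M p f \<le> ennreal K"
        using unit_ball_measurable[OF ball b \<open>0 < K\<close>] unit_ball_cmod_le[OF ball b \<open>0 < K\<close>]
          \<open>0 < K\<close> \<open>1 \<le> p\<close> by (intro Lp_norm_le_sup)
      with \<open>K \<le> \<epsilon>\<close> show ?thesis by (auto intro: order_trans ennreal_leI)
    qed
  qed (auto simp: Lp_space_def)
  then show ?thesis by (simp add: enat_0)
qed

lemma projection_numberE: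
  fixes B :: real
  assumes "ennreal_of_enat (projection_number M I b \<delta> F) \<le> ennreal B" "0 \<le> B"
  obtains \<Lambda> where "finite \<Lambda>" "\<Lambda> \<subseteq> I" "projection_error M b \<Lambda> F \<le> ennreal \<delta>" "card \<Lambda> \<le> B"
proof -
  define C where
    "C = {enat (card \<Lambda>) | \<Lambda>. finite \<Lambda> \<and> \<Lambda> \<subseteq> I \<and> projection_error M b \<Lambda> F \<le> ennreal \<delta>}"
  have N: "projection_number M I b \<delta> F = Inf C"
    by (simp add: projection_number_def C_def)
  have "C \<noteq> {}"
    using assms(1) unfolding N by (auto simp: Inf_enat_def top_unique)
  then have "Inf C \<in> C"
    by (auto simp: Inf_enat_def intro: LeastI)
  then obtain \<Lambda> where \<Lambda>: "finite \<Lambda>" "\<Lambda> \<subseteq> I" "projection_error M b \<Lambda> F \<le> ennreal \<delta>"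
    and "Inf C = enat (card \<Lambda>)"
    by (auto simp: C_def)
  with assms(1) have "ennreal (real (card \<Lambda>)) \<le> ennreal B"
    unfolding N by (simp add: ennreal_of_nat_eq_real_of_nat)
  with \<open>0 \<le> B\<close> have "card \<Lambda> \<le> B" by simp
  with \<Lambda> show thesis by (rule that)
qed

text \<open>
  By the choice of the number of points, the exponential in the existence of good sampling points
  is at least \<open>exp (2 * (1 + X))\<close>. This makes the number linear in \<open>X\<close>, a bound for the logarithm of the
  projection number. The summand 1 pays for rounding up.
\<close>

lemma sampling_complexity_le_log_projection_number:
  assumes bound: "system_bound M I b \<le> ennreal K" and "0 < K"
    and F: "F \<subseteq> wiener_unit_ball M I b"
    and N: "ennreal_of_enat (projection_number M I b \<delta> F) \<le> ennreal (exp X)" and "0 \<le> X" "0 < \<delta>"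
    and "1 \<le> p" "0 < \<epsilon>" and \<delta>: "144 * (2 * K) powr p * \<delta>\<^sup>2 \<le> \<epsilon> powr (p + 2)"
  shows "ennreal_of_enat (sampling_complexity M \<epsilon> F p)
           \<le> ennreal (1 + 16 * K ^ 4 * (1 / \<delta>\<^sup>2)\<^sup>2 * (1 + X))"
proof -
  obtain \<Lambda> where \<Lambda>: "finite \<Lambda>" "\<Lambda> \<subseteq> I" "projection_error M b \<Lambda> F \<le> ennreal \<delta>"
    and card: "card \<Lambda> \<le> exp X"
    by (rule projection_numberE[OF N]) auto
  define Y where "Y = 16 * K ^ 4 * (1 / \<delta>\<^sup>2)\<^sup>2 * (1 + X)"
  have "0 < Y" using \<open>0 < K\<close> \<open>0 < \<delta>\<close> \<open>0 \<le> X\<close> by (simp add: Y_def)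
  define n where "n = nat \<lceil>Y\<rceil>"
  have n: "0 < n" "Y \<le> n" "n \<le> 1 + Y"
    using \<open>0 < Y\<close> unfolding n_def by linarith+
  \<comment> \<open>the factor 4 is absorbed by \<open>(exp 1)\<^sup>2\<close>, which explains the summand 1 in \<open>1 + X\<close>\<close>
  have "4 * (real (card \<Lambda>))\<^sup>2 \<le> 4 * (exp X)\<^sup>2"
    using card by (intro mult_left_mono power_mono) auto
  also have "\<dots> \<le> (exp 1)\<^sup>2 * (exp X)\<^sup>2"
    using power_mono[of 2 "exp 1 :: real" 2] exp_ge_add_one_self[of "1 :: real"]
    by (intro mult_right_mono) auto
  also have "\<dots> = exp (2 * (1 + X))"
    by (simp add: exp_add power2_eq_square flip: exp_add)
  also have "2 * (1 + X) = Y * (\<delta>\<^sup>2)\<^sup>2 / (8 * K ^ 4)"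
    using \<open>0 < K\<close> \<open>0 < \<delta>\<close> by (simp add: Y_def field_simps)
  also have "exp \<dots> \<le> exp (n * (\<delta>\<^sup>2)\<^sup>2 / (8 * K ^ 4))"
    using n(2) \<open>0 < K\<close> by (simp add: divide_right_mono mult_right_mono)
  finally have "4 * (real (card \<Lambda>))\<^sup>2 \<le> exp (n * (\<delta>\<^sup>2)\<^sup>2 / (8 * K ^ 4))" .
  from sampling_complexity_le_of_projection[OF bound \<open>0 < K\<close> F \<Lambda> \<open>0 < \<delta>\<close> n(1) this \<open>1 \<le> p\<close> \<open>0 < \<epsilon>\<close> \<delta>]
  have "ennreal_of_enat (sampling_complexity M \<epsilon> F p) \<le> ennreal_of_enat (enat n)"
    by (simp only: ennreal_of_enat_le_iff)
  also have "\<dots> = ennreal n" by (simp add: ennreal_of_nat_eq_real_of_nat)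
  also have "\<dots> \<le> ennreal (1 + Y)" using n(3) by (rule ennreal_leI)
  finally show ?thesis by (simp add: Y_def)
qed

end

section \<open>Polynomial tractability\<close>

text \<open>
  In terms of \<open>d \<ge> 1\<close> and \<open>z = K / \<epsilon> \<ge> 1\<close> every factor is at most a constant times a monomial with
  nonnegative exponents, so sums are absorbed into products. Only at the end is \<open>z\<close> replaced by its
  value, which adds \<open>\<alpha> * r\<close> to the exponent of \<open>d\<close>.
\<close>

lemma sample_size_polynomial:
  fixes d K \<epsilon> \<delta> A \<kappa> \<alpha> \<beta> \<gamma> s c :: real
  assumes "1 \<le> d" "0 < \<epsilon>" "\<epsilon> \<le> K" "1 \<le> K" "0 < \<kappa>" "0 < A" "0 < c" "0 < \<alpha>" "0 < \<beta>" "0 < \<gamma>" "0 \<le> s" "0 < \<delta>"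
    and K: "K = \<kappa> * d powr \<alpha>"
    and \<delta>: "1 / \<delta>\<^sup>2 \<le> A * (K / \<epsilon>) powr s"
  defines "r \<equiv> 2 * s + s * (\<gamma> / 2)"
  shows "1 + 16 * K ^ 4 * (1 / \<delta>\<^sup>2)\<^sup>2 * (1 + c * d powr \<beta> * \<delta> powr (- \<gamma>))
    \<le> (1 + 16 * \<kappa> ^ 4 * A\<^sup>2 * (1 + c * A powr (\<gamma> / 2))) * \<kappa> powr r
        * d powr (4 * \<alpha> + \<beta> + \<alpha> * r) * \<epsilon> powr (- r)"
proof -
  define z where "z = K / \<epsilon>"
  define m where "m = s * (\<gamma> / 2)"
  have z: "1 \<le> z" using \<open>0 < \<epsilon>\<close> \<open>\<epsilon> \<le> K\<close> by (simp add: z_def)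
  have m: "0 \<le> m" using \<open>0 \<le> s\<close> \<open>0 < \<gamma>\<close> by (simp add: m_def)
  have dz: "1 \<le> d powr \<beta>" "1 \<le> d powr (4 * \<alpha> + \<beta>)" "1 \<le> z powr m" "1 \<le> z powr r"
    using assms(1) \<open>0 < \<alpha>\<close> \<open>0 < \<beta>\<close> \<open>0 \<le> s\<close> \<open>0 < \<gamma>\<close> z m by (auto simp: r_def intro!: ge_one_powr_ge_zero)
  have "\<delta> powr (- \<gamma>) = (1 / \<delta>\<^sup>2) powr (\<gamma> / 2)"
  proof -
    have "1 / \<delta>\<^sup>2 = \<delta> powr (- 2)"
      using \<open>0 < \<delta>\<close> by (simp add: powr_minus_divide)
    then show ?thesis by (simp add: powr_powr)
  qed
  also have "\<dots> \<le> (A * z powr s) powr (\<gamma> / 2)"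
    using \<delta> \<open>0 < \<gamma>\<close> by (intro powr_mono2) (auto simp: z_def)
  also have "\<dots> = A powr (\<gamma> / 2) * z powr m"
    using \<open>0 < A\<close> by (simp add: powr_mult powr_powr m_def)
  finally have X: "\<delta> powr (- \<gamma>) \<le> A powr (\<gamma> / 2) * z powr m" .
  have "1 + c * d powr \<beta> * \<delta> powr (- \<gamma>)
      \<le> d powr \<beta> * z powr m + c * d powr \<beta> * (A powr (\<gamma> / 2) * z powr m)"
    using X dz \<open>0 < c\<close> mult_mono[of 1 "d powr \<beta>" 1 "z powr m"]
    by (intro add_mono mult_left_mono) auto
  also have "\<dots> = (1 + c * A powr (\<gamma> / 2)) * (d powr \<beta> * z powr m)"
    by (simp add: algebra_simps)
  finally have 1: "1 + c * d powr \<beta> * \<delta> powr (- \<gamma>)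
      \<le> (1 + c * A powr (\<gamma> / 2)) * (d powr \<beta> * z powr m)" .
  have 2: "(1 / \<delta>\<^sup>2)\<^sup>2 \<le> A\<^sup>2 * z powr (2 * s)"
  proof -
    have "(1 / \<delta>\<^sup>2)\<^sup>2 \<le> (A * z powr s)\<^sup>2"
      using \<delta> by (intro power_mono) (auto simp: z_def)
    also have "\<dots> = A\<^sup>2 * z powr (2 * s)"
      using z by (simp add: power_mult_distrib powr_power mult.commute)
    finally show ?thesis .
  qed
  have 3: "K ^ 4 = \<kappa> ^ 4 * d powr (4 * \<alpha>)"
    using \<open>1 \<le> d\<close> by (simp add: K power_mult_distrib powr_power mult.commute)
  define H where "H = 16 * \<kappa> ^ 4 * A\<^sup>2 * (1 + c * A powr (\<gamma> / 2))"
  have "0 < H"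
    using \<open>0 < \<kappa>\<close> \<open>0 < A\<close> \<open>0 < c\<close> by (simp add: H_def add_pos_nonneg)
  have "16 * K ^ 4 * (1 / \<delta>\<^sup>2)\<^sup>2 * (1 + c * d powr \<beta> * \<delta> powr (- \<gamma>))
      \<le> 16 * K ^ 4 * (A\<^sup>2 * z powr (2 * s)) * ((1 + c * A powr (\<gamma> / 2)) * (d powr \<beta> * z powr m))"
    using 1 2 \<open>1 \<le> K\<close> \<open>0 < c\<close> by (intro mult_mono) (auto intro!: add_nonneg_nonneg)
  also have "\<dots> = H * d powr (4 * \<alpha> + \<beta>) * z powr r"
    by (simp add: 3 H_def r_def m_def powr_add)
  finally have "1 + 16 * K ^ 4 * (1 / \<delta>\<^sup>2)\<^sup>2 * (1 + c * d powr \<beta> * \<delta> powr (- \<gamma>))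
      \<le> 1 * d powr (4 * \<alpha> + \<beta>) * z powr r + H * d powr (4 * \<alpha> + \<beta>) * z powr r"
    using mult_mono[of 1 "d powr (4 * \<alpha> + \<beta>)" 1 "z powr r"] dz by simp
  also have "\<dots> = (1 + H) * d powr (4 * \<alpha> + \<beta>) * z powr r"
    by (simp add: algebra_simps)
  also have "z powr r = \<kappa> powr r * d powr (\<alpha> * r) * \<epsilon> powr (- r)"
    using \<open>0 < \<kappa>\<close> \<open>0 < \<epsilon>\<close>
    by (simp add: z_def K powr_divide powr_mult powr_powr powr_minus_divide)
  finally show ?thesis
    by (simp add: H_def powr_add mult_ac)
qed

theorem theorem11:
  fixes M :: "nat \<Rightarrow> 'a measure"
    and I :: "nat \<Rightarrow> 'i set"
    and b :: "nat \<Rightarrow> 'i \<Rightarrow> 'a \<Rightarrow> complex"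
    and F :: "nat \<Rightarrow> ('a \<Rightarrow> complex) set"
    and c1 c2 \<alpha> \<beta> \<gamma> :: real
  assumes "\<And>d. d \<ge> 1 \<Longrightarrow> bounded_orthonormal_system (M d) (I d) (b d)"
    and "\<And>d. d \<ge> 1 \<Longrightarrow> F d \<subseteq> wiener_unit_ball (M d) (I d) (b d)"
    and "c1 > 0" "c2 > 0" "\<alpha> > 0" "\<beta> > 0" "\<gamma> > 0"
    and "\<And>d. d \<ge> 1 \<Longrightarrow> system_bound (M d) (I d) (b d) \<le> ennreal (c1 * real d powr \<alpha>)"
    and "\<And>d \<epsilon>. d \<ge> 1 \<Longrightarrow> \<epsilon> > 0 \<Longrightarrow>
           ennreal_of_enat (projection_number (M d) (I d) (b d) \<epsilon> (F d))
             \<le> ennreal (exp (c2 * real d powr \<beta> * \<epsilon> powr (- \<gamma>)))"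
  shows "\<forall>p::real. 1 \<le> p \<longrightarrow> polynomially_tractable M F p"
proof (intro allI impI)
  fix p :: real
  assume "1 \<le> p"
  \<comment> \<open>a bound \<open>K\<close> of at least 1 is needed below, and \<open>c1\<close> may be small\<close>
  define \<kappa> where "\<kappa> = 1 + c1"
  define A where "A = 144 * 2 powr p"
  define r where "r = 2 * (p + 2) + (p + 2) * (\<gamma> / 2)"
  define C where "C = (1 + 16 * \<kappa> ^ 4 * A\<^sup>2 * (1 + c2 * A powr (\<gamma> / 2))) * \<kappa> powr r"
  define q where "q = 4 * \<alpha> + \<beta> + \<alpha> * r"
  have pos: "1 \<le> \<kappa>" "0 < A" "0 \<le> r" "0 \<le> C" "0 \<le> q"
    using assms(3-7) \<open>1 \<le> p\<close> by (auto simp: \<kappa>_def A_def r_def C_def q_def)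
  have "ennreal_of_enat (sampling_complexity (M d) \<epsilon> (F d) p) \<le> ennreal (C * real d powr q * \<epsilon> powr (- r))"
    if "1 \<le> d" "0 < \<epsilon>" for d :: nat and \<epsilon> :: real
  proof -
    interpret bounded_orthonormal_system "M d" "I d" "b d"
      using assms(1) \<open>1 \<le> d\<close> .
    define K where "K = \<kappa> * real d powr \<alpha>"
    have "1 \<le> real d powr \<alpha>"
      using \<open>1 \<le> d\<close> \<open>\<alpha> > 0\<close> by (intro ge_one_powr_ge_zero) auto
    then have "1 \<le> K"
      using pos(1) mult_mono[of 1 \<kappa> 1 "real d powr \<alpha>"] by (simp add: K_def)
    have bound: "system_bound (M d) (I d) (b d) \<le> ennreal K"
      using assms(8)[OF \<open>1 \<le> d\<close>]
      by (rule order_trans) (simp add: K_def \<kappa>_def mult_right_mono ennreal_leI)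
    note F = assms(2)[OF \<open>1 \<le> d\<close>]
    show ?thesis
    proof (cases "K \<le> \<epsilon>")
      case True
      then show ?thesis
        using sampling_complexity_eq_0[OF bound _ F \<open>1 \<le> p\<close>] \<open>1 \<le> K\<close> by simp
    next
      case False
      \<comment> \<open>the largest \<open>\<delta>\<close> allowed by the requirement \<open>144 * (2 * K) powr p * \<delta>\<^sup>2 \<le> \<epsilon> powr (p + 2)\<close>\<close>
      define \<delta> where "\<delta> = sqrt (\<epsilon> powr (p + 2) / (A * K powr p))"
      have \<delta>2: "\<delta>\<^sup>2 = \<epsilon> powr (p + 2) / (A * K powr p)"
        using pos by (simp add: \<delta>_def)
      have "0 < \<delta>"
        using \<open>0 < \<epsilon>\<close> \<open>1 \<le> K\<close> pos(2) by (simp add: \<delta>_def)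
      define X where "X = c2 * real d powr \<beta> * \<delta> powr (- \<gamma>)"
      have "0 \<le> X" using \<open>c2 > 0\<close> by (simp add: X_def)
      have size: "144 * (2 * K) powr p * \<delta>\<^sup>2 \<le> \<epsilon> powr (p + 2)"
        using \<open>1 \<le> K\<close> by (simp add: \<delta>2 A_def powr_mult)
      have "1 / \<delta>\<^sup>2 = A * (K powr p / \<epsilon> powr (p + 2))"
        by (simp add: \<delta>2)
      also have "\<dots> \<le> A * (K powr (p + 2) / \<epsilon> powr (p + 2))"
        using \<open>1 \<le> K\<close> pos(2) by (intro mult_left_mono divide_right_mono powr_mono) auto
      also have "\<dots> = A * (K / \<epsilon>) powr (p + 2)"
        using \<open>1 \<le> K\<close> \<open>0 < \<epsilon>\<close> by (simp add: powr_divide)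
      finally have \<delta>_inv: "1 / \<delta>\<^sup>2 \<le> A * (K / \<epsilon>) powr (p + 2)" .
      have N: "ennreal_of_enat (projection_number (M d) (I d) (b d) \<delta> (F d)) \<le> ennreal (exp X)"
        unfolding X_def using \<open>1 \<le> d\<close> \<open>0 < \<delta>\<close> by (rule assms(9))
      have "ennreal_of_enat (sampling_complexity (M d) \<epsilon> (F d) p)
          \<le> ennreal (1 + 16 * K ^ 4 * (1 / \<delta>\<^sup>2)\<^sup>2 * (1 + X))"
        using \<open>1 \<le> K\<close>
        by (intro sampling_complexity_le_log_projection_number[OF bound _ F N \<open>0 \<le> X\<close> \<open>0 < \<delta>\<close> \<open>1 \<le> p\<close> \<open>0 < \<epsilon>\<close> size]) auto
      also have "\<dots> \<le> ennreal (C * real d powr q * \<epsilon> powr (- r))"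
        unfolding C_def q_def r_def X_def
        using assms(3-7) pos False \<open>1 \<le> d\<close> \<open>0 < \<epsilon>\<close> \<open>1 \<le> K\<close> \<open>1 \<le> p\<close> \<open>0 < \<delta>\<close> \<delta>_inv
        by (intro ennreal_leI sample_size_polynomial) (auto simp: K_def)
      finally show ?thesis .
    qed
  qed
  then show "polynomially_tractable M F p"
    unfolding polynomially_tractable_def using pos(3-5) by blast
qed

end
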